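(* Let $n \ge m \ge 3$ be integers, and let $f(n,m)$ denote the maximal number of connected components of the intersection $P \cap Q$, where $P$ ranges over regions bounded by an $n$-gon and $Q$ ranges over regions bounded by an $m$-gon in the plane. Then $$\left\lfloor \frac{m}{2}\right\rfloor \cdot \left\lfloor \frac{n}{2}\right\rfloor\le f(n,m)\le \left\lfloor \frac{m}{2}\right\rfloor \cdot \frac{n}{2} + \frac{m}{2}.$$
   Context: A polygon ($k$-gon) is a piecewise linear simple closed curve in the plane with $k$ sides; the region it bounds is the bounded component of its complement (the interior). The paper takes these regions to be open; it also asserts that the maximal number of components is the same whether the regions are taken open or closed. *)

theory Defs
  imports "HOL-Analysis.Analysis"
begin

fun polygonal_path :: "complex list \<Rightarrow> real \<Rightarrow> complex" where
  "polygonal_path [] = linepath 0 0"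
| "polygonal_path [a] = linepath a a"
| "polygonal_path [a, b] = linepath a b"
| "polygonal_path (a # b # c # xs) = linepath a b +++ polygonal_path (b # c # xs)"

text \<open>A k-gon with vertex list vs: the closed polygonal curve through
  vs (returning to the first vertex) is a simple closed curve, it has
  exactly k vertices, and it has exactly k sides, i.e. no two consecutive
  sides are collinear (cyclically).\<close>

definition closed_polygon_path :: "complex list \<Rightarrow> real \<Rightarrow> complex" where
  "closed_polygon_path vs = polygonal_path (vs @ [hd vs])"

definition is_kgon :: "nat \<Rightarrow> complex list \<Rightarrow> bool" where
  "is_kgon k vs \<longleftrightarrow> length vs = k \<and> k \<ge> 3 \<and>
     simple_path (closed_polygon_path vs) \<and>
     (\<forall>i<k. \<not> collinear {vs ! i, vs ! ((i + 1) mod k), vs ! ((i + 2) mod k)})"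

definition kgon_region :: "nat \<Rightarrow> complex set \<Rightarrow> bool" where
  "kgon_region k P \<longleftrightarrow>
     (\<exists>vs. is_kgon k vs \<and> P = inside (path_image (closed_polygon_path vs)))"

end

theory Submission
  imports Defs
begin

text \<open>Upper bound. The boundary of \<open>P\<close> meets \<open>Q\<close> in pieces, the components of \<open>e \<inter> Q\<close> for the sides \<open>e\<close> of
  \<open>P\<close>. A line meets \<open>Q\<close> in at most \<open>\<lfloor>m/2\<rfloor>\<close> intervals, because the two ends of each
  interval can be charged to distinct sides of \<open>Q\<close>; so there are at most \<open>n\<lfloor>m/2\<rfloor>\<close> pieces. By the Jordan curve
  theorem only one side of a piece lies in \<open>P\<close>, so each piece bounds only one component of \<open>P \<inter> Q\<close>. A
  component bounded by a single piece has a vertex of \<open>Q\<close> of its own, so at most \<open>m\<close> components have fewer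
  than two pieces. This gives \<open>2c \<le> n\<lfloor>m/2\<rfloor> + m\<close> for the number \<open>c\<close> of components. No general position is needed.

  Lower bound. A comb with \<open>\<lfloor>n/2\<rfloor>\<close> vertical teeth is crossed with a comb with \<open>\<lfloor>m/2\<rfloor>\<close> horizontal ones.\<close>

section \<open>Polygons and their edges\<close>

text \<open>Nothing excludes degenerate positions: sides may overlap or run through vertices of the
  other polygon, so ends of intervals are not simply crossings. An end is therefore charged only to
  a side of \<open>Q\<close> not parallel to the line. Such a side meets the line at most once, and
  an end shared by two intervals lies on two of them. That a piece bounds a single component is
  first a local fact, because a polygonal region is connected in every small disc around a boundary
  point; it spreads along the piece by connectedness. For the lower bound, the inside of a curve is
  known only through the Jordan curve theorem. Points are placed outside by rays that miss the
  curve, and inside by comparing, at the tip of a tooth, the wedge between two sides with such a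
  ray. In a comb all vertices but one lie on a sawtooth with tips at the even positions
  \<open>i < n - 1\<close>, hence \<open>n div 2\<close> tips; the remaining vertex lies far below.
  The valleys lie on a coordinate axis and the other comb strictly on one side of it, so no
  component passes from one tooth to another.\<close>

lemma polygonal_path_Cons:
  "ws \<noteq> [] \<Longrightarrow> tl ws \<noteq> [] \<Longrightarrow> polygonal_path (a # ws) = linepath a (hd ws) +++ polygonal_path ws"
  by (cases ws; cases "tl ws") auto

lemma pathstart_polygonal_path [simp]: "ws \<noteq> [] \<Longrightarrow> pathstart (polygonal_path ws) = hd ws"
  by (induction ws rule: polygonal_path.induct) auto

lemma pathfinish_polygonal_path [simp]: "ws \<noteq> [] \<Longrightarrow> pathfinish (polygonal_path ws) = last ws"
  by (induction ws rule: polygonal_path.induct) auto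

lemma path_image_polygonal_path:
  "2 \<le> length ws \<Longrightarrow>
     path_image (polygonal_path ws) = (\<Union>i<length ws - 1. closed_segment (ws ! i) (ws ! Suc i))"
proof (induction ws rule: polygonal_path.induct)
  case (4 a b c xs)
  have "{..<length (a # b # c # xs) - 1} = insert 0 (Suc ` {..<length (b # c # xs) - 1})"
    by (auto simp: lessThan_Suc_eq_insert_0)
  then show ?case
    using 4 by (simp add: path_image_join del: image_insert image_Suc_lessThan)
qed (auto simp: lessThan_Suc)

lemma arc_polygonal_path_distinct:
  "arc (polygonal_path ws) \<Longrightarrow> Suc i < length ws \<Longrightarrow> ws ! i \<noteq> ws ! Suc i"
proof (induction ws arbitrary: i rule: polygonal_path.induct)
  case (3 a b)
  then show ?case using arc_distinct_ends[of "linepath a b"] by (auto simp: less_Suc_eq)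
next
  case (4 a b c xs)
  then show ?case by (cases i) (auto simp: arc_join_eq dest: arc_distinct_ends)
qed auto

lemma arc_polygonal_path_segments:
  "arc (polygonal_path ws) \<Longrightarrow> i < j \<Longrightarrow> Suc j < length ws \<Longrightarrow>
     closed_segment (ws ! i) (ws ! Suc i) \<inter> closed_segment (ws ! j) (ws ! Suc j)
       \<subseteq> (if j = Suc i then {ws ! j} else {})"
proof (induction ws arbitrary: i j rule: polygonal_path.induct)
  case (4 a b c xs)
  let ?w = "b # c # xs"
  obtain j' where j': "j = Suc j'" using 4 by (cases j) auto
  have arc: "arc (polygonal_path ?w)"
    and meet: "closed_segment a b \<inter> path_image (polygonal_path ?w) \<subseteq> {b}"
    using 4 by (auto simp: arc_join_eq)
  show ?case
  proof (cases i)
    case (Suc i')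
    then show ?thesis using 4(1)[OF arc, of i' j'] 4 j' by auto
  next
    case 0
    have sub: "closed_segment (?w ! j') (?w ! Suc j') \<subseteq> path_image (polygonal_path ?w)"
      using 4 j' by (subst path_image_polygonal_path) auto
    \<comment> \<open>The first segment meets the rest only in \<open>b\<close>. Since
      \<open>b\<close> also lies on the segment from \<open>b\<close> to \<open>c\<close>, the
      induction hypothesis leaves \<open>c\<close> as its only possible position on a later segment,
      and \<open>b = c\<close> is excluded.\<close>
    have "b \<notin> closed_segment (?w ! j') (?w ! Suc j')" if "j' > 0"
    proof
      assume b: "b \<in> closed_segment (?w ! j') (?w ! Suc j')"
      then have "b \<in> (if j' = Suc 0 then {?w ! j'} else {})"
        using IntI[OF _ b, of "closed_segment b c"] 4(1)[OF arc, of 0 j'] that 4(4) j'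
        by (simp add: subset_iff)
      then have "b = c" using 4 by (auto split: if_splits)
      then show False using arc_polygonal_path_distinct[OF arc, of 0] by auto
    qed
    with sub meet have "closed_segment a b \<inter> closed_segment (?w ! j') (?w ! Suc j') \<subseteq> (if j' = 0 then {b} else {})"
      by (cases "j' = 0") (simp, blast)+
    then show ?thesis using 0 j' by (cases j') auto
  qed
qed auto

locale polygon =
  fixes vs :: "complex list" and k :: nat
  assumes kgon: "is_kgon k vs"
begin

definition "edge i = closed_segment (vs ! i) (vs ! (Suc i mod k))"
definition "bd = path_image (closed_polygon_path vs)"

lemma length_vs: "length vs = k" and k_ge3: "k \<ge> 3"
  and simple: "simple_path (closed_polygon_path vs)"
  and noncollinear: "i < k \<Longrightarrow> \<not> collinear {vs ! i, vs ! (Suc i mod k), vs ! (Suc (Suc i) mod k)}"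
  using kgon unfolding is_kgon_def by auto

lemma nth_closed: "i < k \<Longrightarrow> (vs @ [hd vs]) ! i = vs ! i"
  "i < k \<Longrightarrow> (vs @ [hd vs]) ! Suc i = vs ! (Suc i mod k)"
proof -
  show "i < k \<Longrightarrow> (vs @ [hd vs]) ! i = vs ! i"
    using length_vs by (simp add: nth_append)
  show "i < k \<Longrightarrow> (vs @ [hd vs]) ! Suc i = vs ! (Suc i mod k)"
    using length_vs k_ge3 hd_conv_nth[of vs] by (cases "Suc i = k") (force simp: nth_append)+
qed

lemma bd_eq: "bd = (\<Union>i<k. edge i)"
  unfolding bd_def closed_polygon_path_def edge_def
  using length_vs k_ge3 by (subst path_image_polygonal_path) (auto simp: nth_closed)

lemma vertex_neq_next: "i < k \<Longrightarrow> vs ! i \<noteq> vs ! (Suc i mod k)"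
  using noncollinear[of i] by (auto simp: insert_commute)

text \<open>Cutting the closed curve after its first side leaves an arc through the rotated list
  \<open>ws\<close>, which settles all pairs without \<open>edge 0\<close>. The first side meets
  this arc only in its two ends, and the pairs already settled tell which other sides contain these
  ends.\<close>

lemma edge_Int_edge:
  assumes "i < j" "j < k"
  shows "edge i \<inter> edge j \<subseteq> (if j = Suc i then {vs ! j} else if i = 0 \<and> Suc j = k then {vs ! 0} else {})"
proof -
  obtain a b c xs where vs: "vs = a # b # c # xs"
    using length_vs k_ge3 by (metis One_nat_def Suc_le_length_iff numeral_3_eq_3)
  define ws where "ws = b # c # xs @ [a]"
  have "closed_polygon_path vs = linepath a b +++ polygonal_path ws"
    by (simp add: closed_polygon_path_def vs ws_def)
  then have arc: "arc (polygonal_path ws)"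
    and meet: "closed_segment a b \<inter> path_image (polygonal_path ws) \<subseteq> {a, b}"
    using simple by (auto simp: ws_def simple_path_join_loop_eq)
  have lw: "length ws = k" and nw: "\<And>i. i < k \<Longrightarrow> ws ! i = vs ! (Suc i mod k)"
    using length_vs nth_closed(2) by (auto simp: ws_def vs nth_append)
  have wedge: "closed_segment (ws ! i) (ws ! Suc i) = edge (Suc i)" if "Suc i < k" for i
    using that by (simp add: edge_def nw)
  have tail: "edge i \<inter> edge j \<subseteq> (if j = Suc i then {vs ! j} else {})" if lt: "0 < i" "i < j" "j < k" for i j
  proof -
    obtain i' j' where ij: "i = Suc i'" "j = Suc j'"
      using lt by (cases i; cases j) auto
    then show ?thesis
      using arc_polygonal_path_segments[OF arc, of i' j'] lt
      by (simp add: lw nw edge_def split: if_splits)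
  qed
  show ?thesis
  proof (cases "i = 0")
    case False
    then show ?thesis using tail[of i j] assms by auto
  next
    case True
    have "edge j \<subseteq> path_image (polygonal_path ws)"
      unfolding path_image_polygonal_path[of ws, unfolded lw, OF order_trans[OF _ k_ge3], simplified]
      using wedge[of "j - 1"] assms True by (intro UN_upper[of "j - 1", THEN order_trans[rotated]]) auto
    moreover have "edge 0 = closed_segment a b" "vs ! 0 = a" "vs ! 1 = b"
      unfolding edge_def using k_ge3 by (simp_all add: vs)
    ultimately have sub: "edge 0 \<inter> edge j \<subseteq> {vs ! 0, vs ! 1}" using meet by auto
    have "Suc j = k" if "vs ! 0 \<in> edge j"
    proof (rule ccontr)
      assume *: "Suc j \<noteq> k"
      have "vs ! 0 \<in> edge (k - 1)" using k_ge3 by (simp add: edge_def)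
      moreover have "edge j \<inter> edge (k - 1) \<subseteq> (if k - 1 = Suc j then {vs ! (k - 1)} else {})"
        using * assms True by (intro tail) auto
      ultimately have "vs ! 0 \<in> (if k - 1 = Suc j then {vs ! (k - 1)} else {})"
        using that by blast
      then show False using vertex_neq_next[of "k - 1"] k_ge3 by (auto split: if_splits)
    qed
    moreover have "j = 1" if "vs ! 1 \<in> edge j"
    proof (rule ccontr)
      assume *: "j \<noteq> 1"
      have "vs ! 1 \<in> edge 1" by (simp add: edge_def)
      moreover have "edge 1 \<inter> edge j \<subseteq> (if j = Suc 1 then {vs ! j} else {})"
        using * assms True by (intro tail) auto
      ultimately have "vs ! 1 \<in> (if j = Suc 1 then {vs ! j} else {})"
        using that by blast
      then show False using vertex_neq_next[of 1] k_ge3 by (auto split: if_splits simp: numeral_2_eq_2)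
    qed
    ultimately show ?thesis using sub True k_ge3 by auto
  qed
qed

lemma open_segment_edge:
  assumes "i < k" "j < k" "x \<in> open_segment (vs ! i) (vs ! (Suc i mod k))" "x \<in> edge j"
  shows "i = j"
proof (rule ccontr)
  assume ne: "i \<noteq> j"
  have x: "x \<in> edge i" "x \<noteq> vs ! i" "x \<noteq> vs ! (Suc i mod k)"
    using assms by (auto simp: edge_def open_segment_def)
  show False
  proof (cases "i < j")
    case True
    then show ?thesis using edge_Int_edge[of i j] x assms by (auto split: if_splits)
  next
    case False
    then have "j < i" using ne by auto
    then show ?thesis using edge_Int_edge[of j i] x assms by (auto split: if_splits)
  qed
qed

lemma vertex_edge:
  assumes "i < k" "j < k" "vs ! i \<in> edge j"
  shows "j = i \<or> i = Suc j mod k"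
proof (rule ccontr)
  assume ne: "\<not> ?thesis"
  have x: "vs ! i \<in> edge i" by (auto simp: edge_def)
  show False
  proof (cases "i < j")
    case True
    then show ?thesis using edge_Int_edge[of i j] x assms vertex_neq_next[of i] ne
      by (auto split: if_splits)
  next
    case False
    then have "j < i" using ne by auto
    then show ?thesis using edge_Int_edge[of j i] x assms ne vertex_neq_next[of i]
      by (auto split: if_splits)
  qed
qed

end

section \<open>Local structure of the boundary\<close>

text \<open>The determinant of two plane vectors: zero for parallel ones, and its sign distinguishes
  the two sides of a line.\<close>

definition cross :: "complex \<Rightarrow> complex \<Rightarrow> real" where
  "cross u v = Re u * Im v - Im u * Re v"

lemma cross_add_right: "cross u (v + w) = cross u v + cross u w"
  and cross_add_left: "cross (v + w) u = cross v u + cross w u"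
  and cross_diff_right: "cross u (v - w) = cross u v - cross u w"
  and cross_diff_left: "cross (v - w) u = cross v u - cross w u"
  and cross_scaleR_right: "cross u (c *\<^sub>R v) = c * cross u v"
  and cross_scaleR_left: "cross (c *\<^sub>R u) v = c * cross u v"
  and cross_minus_right: "cross u (- v) = - cross u v"
  and cross_minus_left: "cross (- u) v = - cross u v"
  and cross_self: "cross u u = 0"
  and cross_zero: "cross u 0 = 0" "cross 0 u = 0"
  by (simp_all add: cross_def algebra_simps)

lemma cross_commute: "cross u v = - cross v u"
  by (simp add: cross_def)

lemmas cross_simps = cross_add_right cross_add_left cross_diff_right cross_diff_left
  cross_scaleR_right cross_scaleR_left cross_minus_right cross_minus_left cross_self cross_zero

lemma cross_eq_0_imp_scaleR:
  assumes "cross u v = 0" "u \<noteq> 0"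
  obtains c where "v = c *\<^sub>R u"
proof -
  have n: "Re u * Re u + Im u * Im u \<noteq> 0"
    using assms(2) by (simp add: complex_eq_iff sum_squares_eq_zero_iff)
  have "v = ((Re u * Re v + Im u * Im v) / (Re u * Re u + Im u * Im u)) *\<^sub>R u"
    using assms(1) n unfolding cross_def complex_eq_iff
    by (simp add: divide_simps) algebra
  then show ?thesis by (rule that)
qed

lemma cross_neq_0_if_not_collinear:
  assumes "\<not> collinear {p, x, q}"
  shows "cross (q - x) (p - x) \<noteq> 0"
proof
  assume 0: "cross (q - x) (p - x) = 0"
  have "q - x \<noteq> 0" using assms by auto
  with 0 obtain c where "p - x = c *\<^sub>R (q - x)" by (rule cross_eq_0_imp_scaleR)
  then have "collinear {0, q - x, p - x}" by (auto simp: collinear_lemma)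
  then have "collinear {q, x, p}" using collinear_3[of q x p] by (simp add: NO_MATCH_def)
  then show False using assms by (simp add: insert_commute)
qed

text \<open>Cramer's rule. With \<open>d\<close> and \<open>e\<close> the two sides at a vertex, the
  coefficients become the coordinates in which the polygon looks like the boundary of a
  quadrant.\<close>

lemma cross_decompose:
  assumes "cross d e \<noteq> 0"
  shows "w = (cross w e / cross d e) *\<^sub>R d + (cross d w / cross d e) *\<^sub>R e"
proof -
  have "cross d e *\<^sub>R w = cross w e *\<^sub>R d + cross d w *\<^sub>R e"
    by (simp add: complex_eq_iff cross_def algebra_simps)
  then have "(1 / cross d e) *\<^sub>R (cross d e *\<^sub>R w) = (1 / cross d e) *\<^sub>R (cross w e *\<^sub>R d + cross d w *\<^sub>R e)"
    by simp
  then show ?thesis using assms by (simp add: scaleR_add_right)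
qed

lemma convex_cross_pos: "convex {y. 0 < cross u (y - x) * c}"
  and convex_cross_neg: "convex {y. cross u (y - x) * c < 0}"
proof -
  have eq: "cross u (y - x) * c = (c *\<^sub>R Complex (- Im u) (Re u)) \<bullet> y - c * cross u x" for y
    by (simp add: cross_def inner_complex_def algebra_simps)
  show "convex {y. 0 < cross u (y - x) * c}" "convex {y. cross u (y - x) * c < 0}"
    unfolding eq using convex_halfspace_gt convex_halfspace_lt
    by (simp_all add: less_diff_eq diff_less_eq del: inner_scaleR_left)
qed

lemma scaleR_coeff_less_1:
  fixes d v :: "'a::real_normed_vector"
  assumes "v = c *\<^sub>R d" "norm v < norm d"
  shows "c < 1"
proof (rule ccontr)
  assume "\<not> c < 1"
  then have "1 * norm d \<le> \<bar>c\<bar> * norm d" by (intro mult_right_mono) auto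
  then show False using assms by simp
qed

section \<open>The two sides of a polygon near a boundary point\<close>

context polygon
begin

definition "reg = inside bd"
definition "ext = outside bd"

lemma Jordan:
  "reg \<noteq> {}" "open reg" "connected reg" "open ext" "connected ext" "bounded reg" "\<not> bounded ext"
  "reg \<inter> ext = {}" "reg \<union> ext = - bd" "frontier reg = bd" "frontier ext = bd"
proof -
  have "hd (vs @ [hd vs]) = hd vs" using length_vs k_ge3 by (cases vs) auto
  then have "pathfinish (closed_polygon_path vs) = pathstart (closed_polygon_path vs)"
    by (simp add: closed_polygon_path_def)
  from Jordan_inside_outside[OF simple this]
  show "reg \<noteq> {}" "open reg" "connected reg" "open ext" "connected ext" "bounded reg" "\<not> bounded ext"
    "reg \<inter> ext = {}" "reg \<union> ext = - bd" "frontier reg = bd" "frontier ext = bd"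
    unfolding reg_def ext_def bd_def by blast+
qed

lemma connected_reg_or_ext:
  assumes "connected A" "A \<inter> bd = {}"
  shows "A \<subseteq> reg \<or> A \<subseteq> ext"
proof (cases "A \<inter> reg = {}")
  case True
  then show ?thesis using Jordan(9) assms(2) by blast
next
  case False
  then have "A - reg = {}"
    using connected_Int_frontier[OF assms(1), of reg] assms(2) unfolding Jordan(10) by auto
  then show ?thesis by auto
qed

text \<open>Each of the two sign sets of \<open>h\<close> is connected and misses the curve, so it
  lies wholly inside or wholly outside. They cannot lie on the same side, since by the Jordan curve
  theorem \<open>x\<close> is a limit of both the interior and the exterior. The sign
  \<open>s\<close> records which of the two is the interior.\<close>

lemma two_sided:
  assumes "0 < r" "x \<in> bd"
    and h: "\<And>y. y \<in> ball x r \<Longrightarrow> y \<in> bd \<longleftrightarrow> h y = 0"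
    and pos: "connected (ball x r \<inter> {y. 0 < h y})" and neg: "connected (ball x r \<inter> {y. h y < 0})"
  obtains s :: real where "s = 1 \<or> s = -1"
    "\<And>y. y \<in> ball x r \<Longrightarrow> y \<in> reg \<longleftrightarrow> 0 < s * h y" "\<And>y. y \<in> ball x r \<Longrightarrow> y \<in> ext \<longleftrightarrow> s * h y < 0"
proof -
  let ?H1 = "ball x r \<inter> {y. 0 < h y}" and ?H2 = "ball x r \<inter> {y. h y < 0}"
  have sides: "?H1 \<subseteq> reg \<or> ?H1 \<subseteq> ext" "?H2 \<subseteq> reg \<or> ?H2 \<subseteq> ext"
    by (rule connected_reg_or_ext[OF pos], use h in force, rule connected_reg_or_ext[OF neg], use h in force)
  have "x \<in> closure reg" "x \<in> closure ext"
    using assms(2) Jordan(10,11) by (auto simp: frontier_def)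
  then obtain p q where pq: "p \<in> reg" "p \<in> ball x r" "q \<in> ext" "q \<in> ball x r"
    using assms(1) unfolding closure_approachable by (metis dist_commute mem_ball)
  then have nz: "h p \<noteq> 0" "h q \<noteq> 0" using h Jordan(9) by blast+
  have tri: "y \<in> reg \<or> y \<in> ext \<or> h y = 0" "y \<notin> reg \<or> y \<notin> ext" "h y = 0 \<Longrightarrow> y \<notin> reg \<and> y \<notin> ext"
    if "y \<in> ball x r" for y
    using that h[OF that] Jordan(8,9) by auto
  from sides consider "?H1 \<subseteq> reg" "?H2 \<subseteq> ext" | "?H1 \<subseteq> ext" "?H2 \<subseteq> reg"
    | "?H1 \<subseteq> reg" "?H2 \<subseteq> reg" | "?H1 \<subseteq> ext" "?H2 \<subseteq> ext" by blast
  then show ?thesis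
  proof cases
    case 1
    have "y \<in> reg \<longleftrightarrow> 0 < h y" "y \<in> ext \<longleftrightarrow> h y < 0" if "y \<in> ball x r" for y
      using 1 tri[OF that] that by (cases "h y" "0::real" rule: linorder_cases; blast)+
    then show ?thesis using that[of 1] by auto
  next
    case 2
    have "y \<in> reg \<longleftrightarrow> h y < 0" "y \<in> ext \<longleftrightarrow> h y > 0" if "y \<in> ball x r" for y
      using 2 tri[OF that] that by (cases "h y" "0::real" rule: linorder_cases; blast)+
    then show ?thesis using that[of "-1"] by auto
  next
    case 3
    have "q \<in> ?H1 \<union> ?H2" using pq nz by auto
    then show ?thesis using 3 tri(2)[of q] pq by auto
  next
    case 4
    have "p \<in> ?H1 \<union> ?H2" using pq nz by auto
    then show ?thesis using 4 tri(2)[of p] pq by auto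
  qed
qed

lemma isolate_edges:
  obtains r where "0 < r" "\<And>j. j < k \<Longrightarrow> x \<notin> edge j \<Longrightarrow> ball x r \<inter> edge j = {}"
proof -
  let ?F = "\<Union>j\<in>{j. j < k \<and> x \<notin> edge j}. edge j"
  have "closed ?F" by (intro closed_UN) (auto simp: edge_def)
  then have "open (- ?F)" "x \<in> - ?F" by (simp only: open_Compl, blast)
  then obtain r where "0 < r" "ball x r \<subseteq> - ?F" by (meson open_contains_ball)
  then show ?thesis by (intro that[of r]) auto
qed

lemma edge_local:
  assumes "i < k" and x: "x \<in> open_segment (vs ! i) (vs ! (Suc i mod k))"
  obtains r where "0 < r"
    "\<And>y. y \<in> ball x r \<Longrightarrow> y \<in> bd \<longleftrightarrow> cross (vs ! (Suc i mod k) - vs ! i) (y - x) = 0"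
proof -
  define a u where "a = vs ! i" and "u = vs ! (Suc i mod k) - vs ! i"
  have u: "u \<noteq> 0" using vertex_neq_next[OF assms(1)] by (auto simp: u_def)
  have E: "edge i = (\<lambda>t. a + t *\<^sub>R u) ` {0..1}"
    by (auto simp: edge_def closed_segment_def a_def u_def algebra_simps)
  obtain \<tau> where \<tau>: "0 < \<tau>" "\<tau> < 1" "x = a + \<tau> *\<^sub>R u"
    using x by (auto simp: in_segment a_def u_def algebra_simps)
  obtain r0 where r0: "0 < r0" "\<And>j. j < k \<Longrightarrow> x \<notin> edge j \<Longrightarrow> ball x r0 \<inter> edge j = {}"
    using isolate_edges[of x] by metis
  \<comment> \<open>The last two bounds are the distances from \<open>x\<close> to the ends of the
    side, so within the ball the side and its line agree.\<close>
  define r where "r = min r0 (min (\<tau> * norm u) ((1 - \<tau>) * norm u))"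
  show ?thesis
  proof (rule that[of r])
    show "0 < r" using r0 \<tau> u by (simp add: r_def)
    fix y assume y: "y \<in> ball x r"
    have "y \<in> bd \<longleftrightarrow> y \<in> edge i"
    proof
      assume "y \<in> bd"
      then obtain j where j: "j < k" "y \<in> edge j" by (auto simp: bd_eq)
      moreover have "y \<in> ball x r0" using y by (simp add: r_def)
      ultimately have "x \<in> edge j" using r0(2)[of j] by blast
      then show "y \<in> edge i" using open_segment_edge[OF assms(1) j(1) x] j by auto
    qed (use assms(1) in \<open>auto simp: bd_eq\<close>)
    also have "\<dots> \<longleftrightarrow> cross u (y - x) = 0"
    proof
      assume "y \<in> edge i"
      then show "cross u (y - x) = 0" using \<tau> by (auto simp: E cross_simps)
    next
      assume "cross u (y - x) = 0"
      then obtain t where t: "y - x = t *\<^sub>R u" using u by (rule cross_eq_0_imp_scaleR)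
      have "norm (y - x) < r" using y by (simp add: dist_norm norm_minus_commute)
      then have "\<bar>t\<bar> * norm u < \<tau> * norm u" "\<bar>t\<bar> * norm u < (1 - \<tau>) * norm u"
        by (auto simp: t r_def)
      then have "\<bar>t\<bar> < \<tau>" "\<bar>t\<bar> < 1 - \<tau>" using u by auto
      moreover have "y = a + (\<tau> + t) *\<^sub>R u" using t \<tau> by (simp add: algebra_simps)
      ultimately show "y \<in> edge i" unfolding E by (intro image_eqI[of _ _ "\<tau> + t"]) auto
    qed
    finally show "y \<in> bd \<longleftrightarrow> cross (vs ! (Suc i mod k) - vs ! i) (y - x) = 0" by (simp add: u_def)
  qed
qed

text \<open>In the coordinates of \<open>y - x\<close> with respect to \<open>d\<close> and
  \<open>e\<close> the two sides at \<open>x\<close> are the nonnegative half-axes near the origin,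
  and the union of these half-axes is where the minimum of the coordinates vanishes. The minimum is
  positive in the convex wedge between the sides and negative in the complementary sector.\<close>

lemma vertex_local:
  fixes i
  defines "x \<equiv> vs ! (Suc i mod k)"
  defines "d \<equiv> vs ! (Suc (Suc i) mod k) - x" and "e \<equiv> vs ! i - x"
  assumes "i < k"
  obtains r where "0 < r"
    "\<And>y. y \<in> ball x r \<Longrightarrow> y \<in> bd \<longleftrightarrow> min (cross (y - x) e / cross d e) (cross d (y - x) / cross d e) = 0"
proof -
  let ?a = "\<lambda>y. cross (y - x) e / cross d e" and ?b = "\<lambda>y. cross d (y - x) / cross d e"
  have D: "cross d e \<noteq> 0"
    using noncollinear[OF assms(4)] by (simp add: d_def e_def x_def cross_neq_0_if_not_collinear)
  then have de: "d \<noteq> 0" "e \<noteq> 0" by (auto simp: cross_simps)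
  define j where "j = Suc i mod k"
  have jk: "j < k" "Suc j mod k = Suc (Suc i) mod k" using k_ge3 by (auto simp: j_def mod_Suc_eq)
  have E: "edge i = (\<lambda>t. x + t *\<^sub>R e) ` {0..1}"
    unfolding edge_def closed_segment_commute[of "vs ! i"]
    by (auto simp: closed_segment_def e_def x_def algebra_simps)
  have E': "edge j = (\<lambda>t. x + t *\<^sub>R d) ` {0..1}"
    using jk by (auto simp: edge_def closed_segment_def d_def x_def algebra_simps simp flip: j_def)
  obtain r0 where r0: "0 < r0" "\<And>j. j < k \<Longrightarrow> x \<notin> edge j \<Longrightarrow> ball x r0 \<inter> edge j = {}"
    using isolate_edges[of x] by metis
  define r where "r = min r0 (min (norm d) (norm e))"
  show ?thesis
  proof (rule that[of r])
    show "0 < r" using r0 de by (simp add: r_def)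
    fix y assume y: "y \<in> ball x r"
    have only: "l = i \<or> l = j" if "l < k" "x \<in> edge l" for l
    proof -
      have "l = j \<or> j = Suc l mod k" using vertex_edge[of j l] that jk by (simp add: x_def j_def)
      moreover have "l = i" if "Suc i mod k = Suc l mod k"
        using that \<open>l < k\<close> \<open>i < k\<close> by (auto simp: mod_Suc split: if_splits)
      ultimately show ?thesis by (auto simp: j_def)
    qed
    have "y \<in> bd \<longleftrightarrow> y \<in> edge i \<or> y \<in> edge j"
    proof
      assume "y \<in> bd"
      then obtain l where l: "l < k" "y \<in> edge l" by (auto simp: bd_eq)
      moreover have "y \<in> ball x r0" using y by (simp add: r_def)
      ultimately have "x \<in> edge l" using r0(2)[of l] by blast
      then show "y \<in> edge i \<or> y \<in> edge j" using only l by auto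
    qed (use assms(4) jk in \<open>auto simp: bd_eq\<close>)
    also have "y \<in> edge i \<longleftrightarrow> ?a y = 0 \<and> 0 \<le> ?b y"
    proof
      assume "y \<in> edge i"
      then show "?a y = 0 \<and> 0 \<le> ?b y" using D by (auto simp: E cross_simps)
    next
      assume *: "?a y = 0 \<and> 0 \<le> ?b y"
      then have w: "y - x = ?b y *\<^sub>R e" using cross_decompose[OF D, of "y - x"] D by auto
      have "norm (y - x) < norm e" using y by (simp add: dist_norm norm_minus_commute r_def)
      with w have "?b y \<le> 1" by (intro less_imp_le scaleR_coeff_less_1)
      then show "y \<in> edge i" 
        unfolding E using w * by (intro image_eqI[of _ _ "?b y"]) (simp_all add: diff_eq_eq add.commute del: divide_eq_0_iff)
    qed
    also have "y \<in> edge j \<longleftrightarrow> ?b y = 0 \<and> 0 \<le> ?a y"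
    proof
      assume "y \<in> edge j"
      then show "?b y = 0 \<and> 0 \<le> ?a y" using D by (auto simp: E' cross_simps)
    next
      assume *: "?b y = 0 \<and> 0 \<le> ?a y"
      then have w: "y - x = ?a y *\<^sub>R d" using cross_decompose[OF D, of "y - x"] D by auto
      have "norm (y - x) < norm d" using y by (simp add: dist_norm norm_minus_commute r_def)
      with w have "?a y \<le> 1" by (intro less_imp_le scaleR_coeff_less_1)
      then show "y \<in> edge j" 
        unfolding E' using w * by (intro image_eqI[of _ _ "?a y"]) (simp_all add: diff_eq_eq add.commute del: divide_eq_0_iff)
    qed
    finally show "y \<in> bd \<longleftrightarrow> min (?a y) (?b y) = 0" by (auto simp: min_def)
  qed
qed

lemma edge_sides:
  assumes "i < k" and x: "x \<in> open_segment (vs ! i) (vs ! (Suc i mod k))"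
  obtains r s :: real where "0 < r" "s = 1 \<or> s = -1"
    "\<And>y. y \<in> ball x r \<Longrightarrow> y \<in> bd \<longleftrightarrow> cross (vs ! (Suc i mod k) - vs ! i) (y - x) = 0"
    "\<And>y. y \<in> ball x r \<Longrightarrow> y \<in> reg \<longleftrightarrow> 0 < s * cross (vs ! (Suc i mod k) - vs ! i) (y - x)"
    "\<And>y. y \<in> ball x r \<Longrightarrow> y \<in> ext \<longleftrightarrow> s * cross (vs ! (Suc i mod k) - vs ! i) (y - x) < 0"
proof -
  let ?u = "vs ! (Suc i mod k) - vs ! i"
  obtain r where r: "0 < r" "\<And>y. y \<in> ball x r \<Longrightarrow> y \<in> bd \<longleftrightarrow> cross ?u (y - x) = 0"
    using edge_local[OF assms] by metis
  have "x \<in> bd" using r by (simp add: cross_simps)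
  have pos: "connected (ball x r \<inter> {y. 0 < cross ?u (y - x)})"
    and neg: "connected (ball x r \<inter> {y. cross ?u (y - x) < 0})"
    using convex_cross_pos[of ?u x 1] convex_cross_neg[of ?u x 1]
    by (auto intro!: convex_connected convex_Int)
  show ?thesis
  proof (rule two_sided[OF r(1) \<open>x \<in> bd\<close> _ pos neg])
    show "y \<in> bd \<longleftrightarrow> cross ?u (y - x) = 0" if "y \<in> ball x r" for y by (rule r(2)[OF that])
  next
    fix s :: real
    assume "s = 1 \<or> s = -1" "\<And>y. y \<in> ball x r \<Longrightarrow> y \<in> reg \<longleftrightarrow> 0 < s * cross ?u (y - x)"
      "\<And>y. y \<in> ball x r \<Longrightarrow> y \<in> ext \<longleftrightarrow> s * cross ?u (y - x) < 0"
    then show ?thesis using that[OF r(1)] r(2) by blast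
  qed
qed

text \<open>The wedge is convex; the complementary sector is connected as the union of two
  overlapping half discs. Connectedness is exported for every radius because
  \<open>local_connected\<close> needs arbitrarily small balls.\<close>

lemma vertex_sides:
  fixes i
  defines "x \<equiv> vs ! (Suc i mod k)"
  defines "d \<equiv> vs ! (Suc (Suc i) mod k) - x" and "e \<equiv> vs ! i - x"
  assumes "i < k"
  obtains r s :: real where "0 < r" "s = 1 \<or> s = -1"
    "\<And>y. y \<in> ball x r \<Longrightarrow> y \<in> reg \<longleftrightarrow> 0 < s * min (cross (y - x) e / cross d e) (cross d (y - x) / cross d e)"
    "\<And>y. y \<in> ball x r \<Longrightarrow> y \<in> ext \<longleftrightarrow> s * min (cross (y - x) e / cross d e) (cross d (y - x) / cross d e) < 0"
    "\<And>\<rho>. 0 < \<rho> \<Longrightarrow> connected (ball x \<rho> \<inter> {y. 0 < min (cross (y - x) e / cross d e) (cross d (y - x) / cross d e)})"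
    "\<And>\<rho>. 0 < \<rho> \<Longrightarrow> connected (ball x \<rho> \<inter> {y. min (cross (y - x) e / cross d e) (cross d (y - x) / cross d e) < 0})"
proof -
  let ?a = "\<lambda>y. cross (y - x) e / cross d e" and ?b = "\<lambda>y. cross d (y - x) / cross d e"
  let ?h = "\<lambda>y. min (?a y) (?b y)"
  have D: "cross d e \<noteq> 0"
    using noncollinear[OF assms(4)] by (simp add: d_def e_def x_def cross_neq_0_if_not_collinear)
  obtain r where r: "0 < r" "\<And>y. y \<in> ball x r \<Longrightarrow> y \<in> bd \<longleftrightarrow> ?h y = 0"
    using vertex_local[OF assms(4)] unfolding x_def d_def e_def by metis
  have "x \<in> bd" using r by (simp add: cross_simps)
  have a: "?a y = cross e (y - x) * (- 1 / cross d e)" and b: "?b y = cross d (y - x) * (1 / cross d e)" for y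
    using cross_commute[of "y - x" e] by simp_all
  have convs: "convex {y. 0 < ?a y}" "convex {y. 0 < ?b y}" "convex {y. ?a y < 0}" "convex {y. ?b y < 0}"
    unfolding a b by (rule convex_cross_pos convex_cross_pos convex_cross_neg convex_cross_neg)+
  have pos: "connected (ball x \<rho> \<inter> {y. 0 < ?h y})" for \<rho>
  proof -
    have eq: "ball x \<rho> \<inter> {y. 0 < ?h y} = ball x \<rho> \<inter> ({y. 0 < ?a y} \<inter> {y. 0 < ?b y})"
      unfolding min_less_iff_conj by blast
    show ?thesis unfolding eq using convs by (intro convex_connected convex_Int convex_ball)
  qed
  have neg: "connected (ball x \<rho> \<inter> {y. ?h y < 0})" if "0 < \<rho>" for \<rho>
  proof -
    have eq: "ball x \<rho> \<inter> {y. ?h y < 0} = (ball x \<rho> \<inter> {y. ?a y < 0}) \<union> (ball x \<rho> \<inter> {y. ?b y < 0})"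
      unfolding min_less_iff_disj by blast
    define t where "t = \<rho> / (2 * (norm (d + e) + 1))"
    \<comment> \<open>Both coordinates of \<open>z\<close> equal \<open>- t\<close>, so
      \<open>z\<close> lies in both half discs.\<close>
    define z where "z = x - t *\<^sub>R (d + e)"
    have t: "0 < t" "t * norm (d + e) < \<rho>"
    proof -
      show "0 < t" using that by (auto simp: t_def intro!: divide_pos_pos add_nonneg_pos)
      have "0 < 2 * (norm (d + e) + 1)" "norm (d + e) < 2 * (norm (d + e) + 1)"
        by (simp_all add: add_nonneg_pos)
      then have "norm (d + e) / (2 * (norm (d + e) + 1)) < 1" by simp
      with that show "t * norm (d + e) < \<rho>"
        unfolding t_def times_divide_eq_left by (metis mult.right_neutral mult_strict_left_mono times_divide_eq_right)
    qed
    have "?a z < 0" "?b z < 0" "z \<in> ball x \<rho>"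
      using D t that by (auto simp: z_def cross_simps dist_norm divide_simps)
    then have "(ball x \<rho> \<inter> {y. ?a y < 0}) \<inter> (ball x \<rho> \<inter> {y. ?b y < 0}) \<noteq> {}" by blast
    then show ?thesis
      unfolding eq using convs by (intro connected_Un convex_connected convex_Int convex_ball)
  qed
  show ?thesis
  proof (rule two_sided[OF r(1) \<open>x \<in> bd\<close> _ pos neg[OF r(1)]])
    show "y \<in> bd \<longleftrightarrow> ?h y = 0" if "y \<in> ball x r" for y by (rule r(2)[OF that])
  next
    fix s :: real
    assume "s = 1 \<or> s = -1" "\<And>y. y \<in> ball x r \<Longrightarrow> y \<in> reg \<longleftrightarrow> 0 < s * ?h y"
      "\<And>y. y \<in> ball x r \<Longrightarrow> y \<in> ext \<longleftrightarrow> s * ?h y < 0"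
    then show ?thesis using that[OF r(1)] pos neg by blast
  qed
qed

lemma vertex_index_pred:
  assumes "i < k"
  obtains i' where "i' < k" "Suc i' mod k = i"
proof (cases i)
  case 0
  then show ?thesis using that[of "k - 1"] k_ge3 by auto
next
  case (Suc i')
  then show ?thesis using that[of i'] assms by auto
qed

lemma bd_cases:
  assumes "x \<in> bd"
  obtains (vertex) i where "i < k" "x = vs ! (Suc i mod k)"
  | (edge) i where "i < k" "x \<in> open_segment (vs ! i) (vs ! (Suc i mod k))"
proof -
  obtain i where i: "i < k" "x \<in> edge i" using assms by (auto simp: bd_eq)
  obtain i' where i': "i' < k" "Suc i' mod k = i" using vertex_index_pred[OF i(1)] by metis
  show ?thesis
    using i i' vertex[of i'] vertex[of i] edge[of i] by (auto simp: edge_def open_segment_def)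
qed

text \<open>The region has a single branch at each boundary point: a half disc at a side, one of the
  two sectors at a vertex. This is why a point of one boundary inside the other region is a limit of
  only one cell.\<close>

lemma local_connected:
  assumes "x \<in> bd"
  obtains r where "0 < r" "\<And>\<rho>. 0 < \<rho> \<Longrightarrow> \<rho> \<le> r \<Longrightarrow> connected (reg \<inter> ball x \<rho>)"
  using assms
proof (cases rule: bd_cases)
  case (vertex i)
  define h where "h y = min (cross (y - x) (vs ! i - x) / cross (vs ! (Suc (Suc i) mod k) - x) (vs ! i - x))
    (cross (vs ! (Suc (Suc i) mod k) - x) (y - x) / cross (vs ! (Suc (Suc i) mod k) - x) (vs ! i - x))" for y
  obtain r s :: real where rs: "0 < r" "s = 1 \<or> s = -1"
    "\<And>y. y \<in> ball x r \<Longrightarrow> y \<in> reg \<longleftrightarrow> 0 < s * h y"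
    "\<And>\<rho>. 0 < \<rho> \<Longrightarrow> connected (ball x \<rho> \<inter> {y. 0 < h y})"
    "\<And>\<rho>. 0 < \<rho> \<Longrightarrow> connected (ball x \<rho> \<inter> {y. h y < 0})"
    by (rule vertex_sides[OF vertex(1), folded vertex(2), folded h_def]) (rule that)
  show ?thesis
  proof (rule that[OF rs(1)])
    fix \<rho> assume "0 < \<rho>" "\<rho> \<le> r"
    then have "reg \<inter> ball x \<rho> = ball x \<rho> \<inter> {y. 0 < s * h y}" using rs(3) by force
    then show "connected (reg \<inter> ball x \<rho>)"
      using rs(2,4,5) \<open>0 < \<rho>\<close> by auto
  qed
next
  case (edge i)
  let ?u = "vs ! (Suc i mod k) - vs ! i"
  obtain r s :: real where rs: "0 < r" "s = 1 \<or> s = -1"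
    "\<And>y. y \<in> ball x r \<Longrightarrow> y \<in> reg \<longleftrightarrow> 0 < s * cross ?u (y - x)"
    by (rule edge_sides[OF edge]) (rule that)
  show ?thesis
  proof (rule that[OF rs(1)])
    fix \<rho> assume "0 < \<rho>" "\<rho> \<le> r"
    then have "reg \<inter> ball x \<rho> = ball x \<rho> \<inter> {y. 0 < cross ?u (y - x) * s}"
      using rs(3) by (force simp: mult.commute)
    then show "connected (reg \<inter> ball x \<rho>)"
      using convex_cross_pos by (simp add: convex_connected convex_Int)
  qed
qed

end

section \<open>Intersecting a line with a polygonal region\<close>

context polygon
begin

text \<open>\<open>\<delta>\<close> is the infimum of the closed set of times spent outside the
  region, a nonempty set because the region is bounded.\<close>

lemma first_exit:
  assumes "x \<in> reg" "u \<noteq> 0"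
  obtains \<delta> where "0 < \<delta>" "x + \<delta> *\<^sub>R u \<in> bd" "\<And>s. 0 \<le> s \<Longrightarrow> s < \<delta> \<Longrightarrow> x + s *\<^sub>R u \<in> reg"
proof -
  let ?L = "\<lambda>s. x + s *\<^sub>R u"
  define S where "S = {0..} \<inter> ?L -` (- reg)"
  have closed: "closed S"
    unfolding S_def using Jordan(2) by (intro closed_Int closed_vimage) (auto intro!: continuous_intros)
  obtain B where B: "\<And>y. y \<in> reg \<Longrightarrow> norm y \<le> B" using Jordan(6) by (auto simp: bounded_iff)
  have "(\<bar>B\<bar> + norm x + 1) / norm u \<in> S"
  proof -
    let ?s = "(\<bar>B\<bar> + norm x + 1) / norm u"
    have "norm (?s *\<^sub>R u) \<le> norm (?L ?s) + norm x" using norm_triangle_ineq4[of "?L ?s" x] by simp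
    then have "B < norm (?L ?s)" using assms(2) by simp
    then show ?thesis using B[of "?L ?s"] by (force simp: S_def)
  qed
  then have ne: "S \<noteq> {}" by auto
  have bdd: "bdd_below S" by (intro bdd_belowI[of _ 0]) (auto simp: S_def)
  define \<delta> where "\<delta> = Inf S"
  have mem: "\<delta> \<in> S" unfolding \<delta>_def by (rule closed_contains_Inf[OF ne bdd closed])
  have less: "?L s \<in> reg" if "0 \<le> s" "s < \<delta>" for s
    using cInf_lower[OF _ bdd, of s] that by (auto simp: S_def \<delta>_def)
  have pos: "0 < \<delta>" using mem assms(1) by (cases "\<delta> = 0") (auto simp: S_def)
  \<comment> \<open>The exterior is open, so an exit point in it would have exterior points just
    before it.\<close>
  have "?L \<delta> \<notin> ext"
  proof
    assume *: "?L \<delta> \<in> ext"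
    have "open (?L -` ext)" using Jordan(4) by (intro open_vimage continuous_intros)
    then obtain e where e: "0 < e" "ball \<delta> e \<subseteq> ?L -` ext" using * by (force simp: open_contains_ball)
    define s where "s = max 0 (\<delta> - e / 2)"
    have "s \<in> ball \<delta> e" "0 \<le> s" "s < \<delta>" using e pos by (auto simp: s_def dist_real_def)
    then show False using e less[of s] Jordan(8) by auto
  qed
  then have "?L \<delta> \<in> bd" using mem Jordan(9) by (auto simp: S_def)
  then show ?thesis using that[of \<delta>] pos less by blast
qed

text \<open>The sides that ends of intervals are charged to. Sides parallel to \<open>u\<close> are
  left out because one of them can lie along the line and contain several ends; a transversal side
  meets the line once.\<close>

definition transversal :: "complex \<Rightarrow> complex \<Rightarrow> nat set" where
  "transversal u x = {j. j < k \<and> x \<in> edge j \<and> cross u (vs ! (Suc j mod k) - vs ! j) \<noteq> 0}"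

lemma transversal_unique:
  assumes "j \<in> transversal u (a + s *\<^sub>R u)" "j \<in> transversal u (a + t *\<^sub>R u)"
  shows "s = t"
proof -
  define w where "w = vs ! (Suc j mod k) - vs ! j"
  have w: "cross u w \<noteq> 0" using assms by (simp add: transversal_def w_def)
  have e: "edge j = (\<lambda>t. vs ! j + t *\<^sub>R w) ` {0..1}"
    by (auto simp: edge_def closed_segment_def w_def algebra_simps)
  obtain p q where pq: "a + s *\<^sub>R u = vs ! j + p *\<^sub>R w" "a + t *\<^sub>R u = vs ! j + q *\<^sub>R w"
    using assms by (auto simp: transversal_def e)
  have "(s - t) *\<^sub>R u = (a + s *\<^sub>R u) - (a + t *\<^sub>R u)" by (simp add: scaleR_left_diff_distrib)
  also have "\<dots> = (p - q) *\<^sub>R w" unfolding pq by (simp add: scaleR_left_diff_distrib)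
  finally have "cross ((s - t) *\<^sub>R u) w = cross ((p - q) *\<^sub>R w) w" by simp
  then show ?thesis using w by (simp add: cross_simps)
qed

text \<open>For \<open>x\<close> on the boundary: \<open>x\<close> is the end of an interval of the
  region that extends in direction \<open>u\<close>. If \<open>clear (- u) x\<close> holds too, two
  intervals share this end.\<close>

definition clear :: "complex \<Rightarrow> complex \<Rightarrow> bool" where
  "clear u x \<longleftrightarrow> (\<exists>\<epsilon>>0. \<forall>s. 0 < s \<and> s < \<epsilon> \<longrightarrow> x + s *\<^sub>R u \<in> reg)"

lemma not_clear_along_edge:
  assumes "j < k" "x \<in> edge j" "x + c *\<^sub>R u \<in> edge j" "0 < c"
  shows "\<not> clear u x"
proof
  assume "clear u x"
  then obtain \<epsilon> where e: "0 < \<epsilon>" "\<And>s. 0 < s \<Longrightarrow> s < \<epsilon> \<Longrightarrow> x + s *\<^sub>R u \<in> reg" by (auto simp: clear_def)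
  define s where "s = min c (\<epsilon> / 2)"
  have s: "0 < s" "s < \<epsilon>" "s \<le> c" using e assms by (auto simp: s_def)
  have "x + s *\<^sub>R u = (1 - s / c) *\<^sub>R x + (s / c) *\<^sub>R (x + c *\<^sub>R u)"
    using assms by (simp add: algebra_simps)
  also have "\<dots> \<in> edge j"
    using assms s by (intro convexD_alt) (auto simp: edge_def divide_le_eq)
  finally have "x + s *\<^sub>R u \<in> bd" using assms by (auto simp: bd_eq)
  then show False using e(2)[OF s(1,2)] Jordan(9) by blast
qed

text \<open>A side through \<open>x\<close> parallel to \<open>u\<close> blocks every direction in
  which it continues beyond \<open>x\<close>: at least one of \<open>u\<close> and
  \<open>- u\<close>, and both when \<open>x\<close> is not an end of the side.\<close>

lemma parallel_edge_not_clear: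
  assumes "j < k" "x \<in> edge j" "cross u (vs ! (Suc j mod k) - vs ! j) = 0" "u \<noteq> 0"
  shows "\<not> clear u x \<or> \<not> clear (- u) x"
    and "x \<in> open_segment (vs ! j) (vs ! (Suc j mod k)) \<Longrightarrow> \<not> clear u x \<and> \<not> clear (- u) x"
proof -
  define w where "w = vs ! (Suc j mod k) - vs ! j"
  have w: "w \<noteq> 0" using vertex_neq_next[OF assms(1)] by (auto simp: w_def)
  obtain c where c: "w = c *\<^sub>R u" using assms(3,4) cross_eq_0_imp_scaleR[of u w] by (auto simp: w_def)
  then have c0: "c \<noteq> 0" using w by auto
  obtain t where t: "0 \<le> t" "t \<le> 1" "x = vs ! j + t *\<^sub>R w"
    using assms(2) by (auto simp: edge_def closed_segment_def w_def algebra_simps)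
  have ends: "x + ((1 - t) * c) *\<^sub>R u \<in> edge j" "x + (- t * c) *\<^sub>R u \<in> edge j"
    using t(3) c by (auto simp: edge_def w_def algebra_simps)
  have clear_pos: "\<not> clear u x" if "t < 1" "0 < c" using not_clear_along_edge[OF assms(1,2) ends(1)] that by simp
  have clear_pos': "\<not> clear u x" if "0 < t" "c < 0" using not_clear_along_edge[OF assms(1,2) ends(2)] that
    by (simp add: mult_pos_neg)
  have clear_neg: "\<not> clear (- u) x" if "0 < t" "0 < c"
    using not_clear_along_edge[OF assms(1,2), of "t * c" "- u"] ends(2) that by simp
  have clear_neg': "\<not> clear (- u) x" if "t < 1" "c < 0"
    using not_clear_along_edge[OF assms(1,2), of "(1 - t) * (- c)" "- u"] ends(1) that
    by (simp add: mult_pos_neg)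
  show "\<not> clear u x \<or> \<not> clear (- u) x"
    using clear_pos clear_pos' clear_neg clear_neg' c0 t by (cases "t < 1"; cases "0 < c") auto
  assume "x \<in> open_segment (vs ! j) (vs ! (Suc j mod k))"
  then have "x \<noteq> vs ! j" "x \<noteq> vs ! (Suc j mod k)" by (auto simp: open_segment_def)
  then have "t \<noteq> 0" "t \<noteq> 1" using t(3) by (auto simp: w_def)
  then show "\<not> clear u x \<and> \<not> clear (- u) x"
    using clear_pos clear_pos' clear_neg clear_neg' c0 t by (cases "0 < c") auto
qed

lemma vertex_in_edges:
  assumes "i < k"
  shows "vs ! (Suc i mod k) \<in> edge i" "vs ! (Suc i mod k) \<in> edge (Suc i mod k)"
  unfolding edge_def by (rule ends_in_segment)+

text \<open>In the relative interior of a side, a parallel side would block both directions. At a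
  vertex, the two sides are not collinear, so they are not both parallel to
  \<open>u\<close>.\<close>

lemma transversal_nonempty:
  assumes "x \<in> bd" "u \<noteq> 0" "clear u x \<or> clear (- u) x"
  shows "transversal u x \<noteq> {}"
  using assms(1)
proof (cases rule: bd_cases)
  case (edge i)
  then have "x \<in> edge i" by (auto simp: edge_def open_segment_def)
  moreover have "cross u (vs ! (Suc i mod k) - vs ! i) \<noteq> 0"
    using parallel_edge_not_clear(2)[OF edge(1) \<open>x \<in> edge i\<close> _ assms(2) edge(2)] assms(3) by blast
  ultimately show ?thesis using edge by (auto simp: transversal_def)
next
  case (vertex i)
  define j where "j = Suc i mod k"
  have j: "j < k" "Suc j mod k = Suc (Suc i) mod k" using k_ge3 by (auto simp: j_def mod_Suc_eq)
  have D: "cross (vs ! (Suc j mod k) - x) (vs ! i - x) \<noteq> 0"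
    using noncollinear[OF vertex(1)] j by (simp add: vertex cross_neq_0_if_not_collinear)
  have "cross u (x - vs ! i) \<noteq> 0 \<or> cross u (vs ! (Suc j mod k) - x) \<noteq> 0"
  proof (rule ccontr)
    assume "\<not> ?thesis"
    then obtain c c' where "x - vs ! i = c *\<^sub>R u" "vs ! (Suc j mod k) - x = c' *\<^sub>R u"
      using cross_eq_0_imp_scaleR assms(2) by metis
    moreover from this have "vs ! i - x = (- c) *\<^sub>R u" by (simp add: algebra_simps)
    ultimately show False using D by (simp add: cross_simps)
  qed
  then have "i \<in> transversal u x \<or> j \<in> transversal u x"
    using vertex vertex_in_edges[OF vertex(1)] j by (auto simp: transversal_def j_def)
  then show ?thesis by auto
qed

text \<open>A shared end must be a vertex: in the relative interior of a side the points just before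
  and just after \<open>x\<close> would have to lie on the same side of it. At a vertex a parallel
  side would block one of the two directions, so both sides are transversal.\<close>

lemma transversal_two:
  assumes "x \<in> bd" "u \<noteq> 0" "clear u x" "clear (- u) x"
  obtains i j where "i \<in> transversal u x" "j \<in> transversal u x" "i \<noteq> j"
  using assms(1)
proof (cases rule: bd_cases)
  case (vertex i)
  define j where "j = Suc i mod k"
  have "j < k" using k_ge3 by (auto simp: j_def)
  moreover have "x \<in> edge i" "x \<in> edge j" using vertex vertex_in_edges[OF vertex(1)] by (auto simp: j_def)
  ultimately have "i \<in> transversal u x" "j \<in> transversal u x"
    using vertex(1) parallel_edge_not_clear(1)[OF _ _ _ assms(2), of _ x] assms(3,4)
    by (auto simp: transversal_def)
  moreover have "i \<noteq> j" using vertex_neq_next[OF vertex(1)] by (auto simp: j_def)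
  ultimately show ?thesis by (rule that)
next
  case (edge i)
  let ?w = "vs ! (Suc i mod k) - vs ! i"
  obtain r s :: real where rs: "0 < r" "s = 1 \<or> s = -1"
    "\<And>y. y \<in> ball x r \<Longrightarrow> y \<in> reg \<longleftrightarrow> 0 < s * cross ?w (y - x)"
    by (rule edge_sides[OF edge]) (rule that)
  obtain e1 e2 where e: "0 < e1" "\<And>s. 0 < s \<Longrightarrow> s < e1 \<Longrightarrow> x + s *\<^sub>R u \<in> reg"
     "0 < e2" "\<And>s. 0 < s \<Longrightarrow> s < e2 \<Longrightarrow> x + s *\<^sub>R (- u) \<in> reg"
    using assms(3,4) unfolding clear_def by metis
  have "0 < min (min e1 e2) (r / norm u)" using e rs assms(2) by simp
  then obtain t where t: "0 < t" "t < e1" "t < e2" "t < r / norm u" by (meson dense min_less_iff_conj)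
  then have "t * norm u < r" using assms(2) by (simp add: field_simps)
  then have "x + t *\<^sub>R u \<in> ball x r" "x + t *\<^sub>R (- u) \<in> ball x r" using t by (auto simp: dist_norm)
  then have "0 < s * cross ?w (t *\<^sub>R u)" "0 < s * cross ?w (t *\<^sub>R (- u))"
    using rs(3) e(2)[of t] e(4)[of t] t by fastforce+
  then show ?thesis by (simp add: cross_simps)
qed

text \<open>Each of the two ends of an interval of the region on a line lies on an edge transversal to
  the line; where two intervals share an end there are two such edges, so the least and the
  greatest such index differ.\<close>

lemma card_components_segment:
  assumes "a \<noteq> b"
  shows "finite (components (closed_segment a b \<inter> reg)) \<and> card (components (closed_segment a b \<inter> reg)) \<le> k div 2"
\<comment> \<open>Bounding all finite subfamilies gives finiteness and the bound together.\<close>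
proof (rule finite_if_finite_subsets_card_bdd)
  fix \<D> assume \<D>: "\<D> \<subseteq> components (closed_segment a b \<inter> reg)" and fin: "finite \<D>"
  define u where "u = b - a"
  define L where "L t = a + t *\<^sub>R u" for t
  have u: "u \<noteq> 0" using assms by (simp add: u_def)
  have seg: "closed_segment a b = L ` {0..1}"
    unfolding closed_segment_image_interval
    by (intro image_cong) (simp_all add: L_def u_def algebra_simps)
  have sub: "C \<subseteq> closed_segment a b" "C \<subseteq> reg" "C \<noteq> {}" if "C \<in> \<D>" for C
    using that \<D> in_components_nonempty[of C] in_components_subset[of C] by auto
  have "\<forall>C\<in>\<D>. \<exists>t. t \<in> {0..1} \<and> L t \<in> C"
  proof
    fix C assume "C \<in> \<D>"
    then obtain y where "y \<in> C" "y \<in> L ` {0..1}" using sub[of C] seg by blast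
    then show "\<exists>t. t \<in> {0..1} \<and> L t \<in> C" by auto
  qed
  from bchoice[OF this] obtain \<tau> where \<tau>: "\<And>C. C \<in> \<D> \<Longrightarrow> \<tau> C \<in> {0..1} \<and> L (\<tau> C) \<in> C" by auto
  have \<tau>reg: "L (\<tau> C) \<in> reg" if "C \<in> \<D>" for C
    using \<tau>[OF that] sub[OF that] by auto
  \<comment> \<open>The exits are sought along the whole line, so the parameters \<open>lo C\<close>
    and \<open>hi C\<close> derived from them may leave the unit interval; only
    \<open>\<tau> C\<close> is known to lie in it.\<close>
  have exits: "\<forall>C\<in>\<D>. \<exists>\<delta>. 0 < \<delta> \<and> L (\<tau> C) + \<delta> *\<^sub>R v \<in> bd \<and> (\<forall>s. 0 \<le> s \<and> s < \<delta> \<longrightarrow> L (\<tau> C) + s *\<^sub>R v \<in> reg)"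
    if v: "v \<noteq> 0" for v
  proof
    fix C assume "C \<in> \<D>"
    obtain \<delta> where "0 < \<delta>" "L (\<tau> C) + \<delta> *\<^sub>R v \<in> bd" "\<And>s. 0 \<le> s \<Longrightarrow> s < \<delta> \<Longrightarrow> L (\<tau> C) + s *\<^sub>R v \<in> reg"
      by (rule first_exit[OF \<tau>reg[OF \<open>C \<in> \<D>\<close>] v]) (rule that)
    then show "\<exists>\<delta>. 0 < \<delta> \<and> L (\<tau> C) + \<delta> *\<^sub>R v \<in> bd \<and> (\<forall>s. 0 \<le> s \<and> s < \<delta> \<longrightarrow> L (\<tau> C) + s *\<^sub>R v \<in> reg)"
      by blast
  qed
  from bchoice[OF exits[OF u]] obtain \<beta> where \<beta>: "\<And>C. C \<in> \<D> \<Longrightarrow> 0 < \<beta> C"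
      "\<And>C. C \<in> \<D> \<Longrightarrow> L (\<tau> C) + \<beta> C *\<^sub>R u \<in> bd"
      "\<And>C s. C \<in> \<D> \<Longrightarrow> 0 \<le> s \<Longrightarrow> s < \<beta> C \<Longrightarrow> L (\<tau> C) + s *\<^sub>R u \<in> reg" by blast
  have "- u \<noteq> 0" using u by simp
  from bchoice[OF exits[OF this]] obtain \<alpha> where \<alpha>: "\<And>C. C \<in> \<D> \<Longrightarrow> 0 < \<alpha> C"
      "\<And>C. C \<in> \<D> \<Longrightarrow> L (\<tau> C) + \<alpha> C *\<^sub>R (-u) \<in> bd"
      "\<And>C s. C \<in> \<D> \<Longrightarrow> 0 \<le> s \<Longrightarrow> s < \<alpha> C \<Longrightarrow> L (\<tau> C) + s *\<^sub>R (-u) \<in> reg" by blast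
  define lo hi where "lo C = \<tau> C - \<alpha> C" and "hi C = \<tau> C + \<beta> C" for C
  have Llo: "L (\<tau> C) + \<alpha> C *\<^sub>R (-u) = L (lo C)" and Lhi: "L (\<tau> C) + \<beta> C *\<^sub>R u = L (hi C)" for C
    by (simp_all add: L_def lo_def hi_def algebra_simps)
  have lo: "lo C < \<tau> C" "L (lo C) \<in> bd" "clear u (L (lo C))" if "C \<in> \<D>" for C
  proof -
    show "lo C < \<tau> C" "L (lo C) \<in> bd" using \<alpha>[OF that] Llo[of C] by (auto simp: lo_def)
    have "L (lo C) + s *\<^sub>R u \<in> reg" if "0 < s" "s < \<alpha> C" for s
      using \<alpha>(3)[OF \<open>C \<in> \<D>\<close>, of "\<alpha> C - s"] that by (simp add: L_def lo_def algebra_simps)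
    then show "clear u (L (lo C))" unfolding clear_def using \<alpha>(1)[OF that] by blast
  qed
  have hi: "\<tau> C < hi C" "L (hi C) \<in> bd" "clear (- u) (L (hi C))" if "C \<in> \<D>" for C
  proof -
    show "\<tau> C < hi C" "L (hi C) \<in> bd" using \<beta>[OF that] Lhi[of C] by (auto simp: hi_def)
    have "L (hi C) + s *\<^sub>R (- u) \<in> reg" if "0 < s" "s < \<beta> C" for s
      using \<beta>(3)[OF \<open>C \<in> \<D>\<close>, of "\<beta> C - s"] that by (simp add: L_def hi_def algebra_simps)
    then show "clear (- u) (L (hi C))" unfolding clear_def using \<beta>(1)[OF that] by blast
  qed
  have gap: "hi C \<le> lo C'" if C: "C \<in> \<D>" "C' \<in> \<D>" "\<tau> C < \<tau> C'" for C C'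
  proof -
    have "C \<noteq> C'" using C by auto
    \<comment> \<open>Otherwise the stretch between the two chosen points would be a connected part
      of both components.\<close>
    have "\<exists>g. \<tau> C \<le> g \<and> g \<le> \<tau> C' \<and> L g \<notin> reg"
    proof (rule ccontr)
      assume *: "\<not> ?thesis"
      have "L ` {\<tau> C..\<tau> C'} \<subseteq> closed_segment a b \<inter> reg"
        using * \<tau>[OF C(1)] \<tau>[OF C(2)] unfolding seg by auto
      moreover have "connected (L ` {\<tau> C..\<tau> C'})"
        unfolding L_def by (intro connected_continuous_image continuous_intros) auto
      moreover have "L (\<tau> C) \<in> C \<inter> L ` {\<tau> C..\<tau> C'}" "L (\<tau> C') \<in> C' \<inter> L ` {\<tau> C..\<tau> C'}"
        using \<tau> C by auto
      ultimately have "L ` {\<tau> C..\<tau> C'} \<subseteq> C" "L ` {\<tau> C..\<tau> C'} \<subseteq> C'"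
        using components_maximal C \<D> by blast+
      then have "L (\<tau> C) \<in> C \<inter> C'" using C by auto
      then show False using components_nonoverlap C \<D> \<open>C \<noteq> C'\<close> by blast
    qed
    then obtain g where g: "\<tau> C \<le> g" "g \<le> \<tau> C'" "L g \<notin> reg" by auto
    have "hi C \<le> g"
    proof (rule ccontr)
      assume "\<not> hi C \<le> g"
      then show False using \<beta>(3)[OF C(1), of "g - \<tau> C"] g by (simp add: L_def hi_def algebra_simps)
    qed
    moreover have "g \<le> lo C'"
    proof (rule ccontr)
      assume "\<not> g \<le> lo C'"
      then show False using \<alpha>(3)[OF C(2), of "\<tau> C' - g"] g by (simp add: L_def lo_def algebra_simps)
    qed
    ultimately show ?thesis by simp
  qed
  have \<tau>inj: "C = C'" if "C \<in> \<D>" "C' \<in> \<D>" "\<tau> C = \<tau> C'" for C C'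
    using \<tau>[OF that(1)] \<tau>[OF that(2)] that \<D> components_nonoverlap[of C "closed_segment a b \<inter> reg" C'] by auto
  \<comment> \<open>The Boolean chooses the end of the interval. Two lower ends, or two upper ends,
    never coincide; \<open>Min\<close> and \<open>Max\<close> are needed only where an upper end
    meets a lower one.\<close>
  define \<phi> where "\<phi> = (\<lambda>(C, p). if p then Max (transversal u (L (hi C))) else Min (transversal u (L (lo C))))"
  have fintr: "finite (transversal u x)" for x by (rule finite_subset[of _ "{..<k}"]) (auto simp: transversal_def)
  have Max: "Max (transversal u (L (hi C))) \<in> transversal u (L (hi C))" if "C \<in> \<D>" for C
    using hi[OF that] u by (intro Max_in fintr transversal_nonempty) auto
  have Min: "Min (transversal u (L (lo C))) \<in> transversal u (L (lo C))" if "C \<in> \<D>" for C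
    using lo[OF that] u by (intro Min_in fintr transversal_nonempty) auto
  have uniq: "s = t" if "j \<in> transversal u (L s)" "j \<in> transversal u (L t)" for j s t
    using transversal_unique that by (simp add: L_def)
  have lo_inj: "C = C'" if "C \<in> \<D>" "C' \<in> \<D>" "lo C = lo C'" for C C'
    using gap[OF that(1,2)] gap[OF that(2,1)] hi(1)[OF that(1)] hi(1)[OF that(2)] lo(1)[OF that(1)] lo(1)[OF that(2)] that \<tau>inj[OF that(1,2)]
    by (cases "\<tau> C" "\<tau> C'" rule: linorder_cases) auto
  have hi_inj: "C = C'" if "C \<in> \<D>" "C' \<in> \<D>" "hi C = hi C'" for C C'
    using gap[OF that(1,2)] gap[OF that(2,1)] hi(1)[OF that(1)] hi(1)[OF that(2)] lo(1)[OF that(1)] lo(1)[OF that(2)] that \<tau>inj[OF that(1,2)]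
    by (cases "\<tau> C" "\<tau> C'" rule: linorder_cases) auto
  have lohi: "Min (transversal u (L (lo C))) \<noteq> Max (transversal u (L (hi C')))" if C: "C \<in> \<D>" "C' \<in> \<D>" for C C'
  proof
    assume eq: "Min (transversal u (L (lo C))) = Max (transversal u (L (hi C')))"
    have "lo C = hi C'" using uniq[of _ "lo C" "hi C'"] Min[OF C(1)] Max[OF C(2)] eq by metis
    then obtain i j where ij: "i \<in> transversal u (L (lo C))" "j \<in> transversal u (L (lo C))" "i \<noteq> j"
      using transversal_two[OF lo(2)[OF C(1)] u lo(3)[OF C(1)]] hi(3)[OF C(2)] by metis
    have "i = j" using Min_le[OF fintr ij(1)] Min_le[OF fintr ij(2)] Max_ge[OF fintr ij(1)] Max_ge[OF fintr ij(2)]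
        eq \<open>lo C = hi C'\<close> by simp
    then show False using ij by simp
  qed
  have "inj_on \<phi> (\<D> \<times> UNIV)"
  proof (rule inj_onI)
    fix p q assume pq: "p \<in> \<D> \<times> UNIV" "q \<in> \<D> \<times> UNIV" "\<phi> p = \<phi> q"
    obtain C c D d where [simp]: "p = (C, c)" "q = (D, d)" by (cases p; cases q)
    have C: "C \<in> \<D>" "D \<in> \<D>" using pq by auto
    show "p = q"
    proof (cases c; cases d)
      assume "c" "d"
      then have "Max (transversal u (L (hi C))) = Max (transversal u (L (hi D)))" using pq by (simp add: \<phi>_def)
      then have "hi C = hi D" using uniq[of _ "hi C" "hi D"] Max C by metis
      then show ?thesis using hi_inj C \<open>c\<close> \<open>d\<close> by simp
    next
      assume "\<not> c" "\<not> d"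
      then have "Min (transversal u (L (lo C))) = Min (transversal u (L (lo D)))" using pq by (simp add: \<phi>_def)
      then have "lo C = lo D" using uniq[of _ "lo C" "lo D"] Min C by metis
      then show ?thesis using lo_inj C \<open>\<not> c\<close> \<open>\<not> d\<close> by simp
    next
      assume "c" "\<not> d"
      then show ?thesis using lohi[OF C(2,1)] pq by (simp add: \<phi>_def)
    next
      assume "\<not> c" "d"
      then show ?thesis using lohi[OF C] pq by (simp add: \<phi>_def)
    qed
  qed
  moreover have "\<phi> ` (\<D> \<times> UNIV) \<subseteq> {..<k}"
    using Max Min by (fastforce simp: \<phi>_def transversal_def)
  ultimately have "card (\<D> \<times> (UNIV :: bool set)) \<le> card {..<k}"
    by (intro card_inj_on_le[of \<phi>]) auto
  then show "card \<D> \<le> k div 2" by (simp add: card_cartesian_product)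
qed

end

section \<open>The upper bound\<close>

lemma line_convex_closed:
  assumes "u \<noteq> 0"
  shows "convex {y. cross u (y - x) = 0}" "closed {y. cross u (y - x) = 0}"
    "interior {y. cross u (y - x) = 0} = {}"
proof -
  define v where "v = Complex (- Im u) (Re u)"
  have v: "v \<noteq> 0" using assms by (auto simp: v_def complex_eq_iff)
  have eq: "{y. cross u (y - x) = 0} = {y. v \<bullet> y = cross u x}"
    by (auto simp: v_def cross_def inner_complex_def algebra_simps)
  show "convex {y. cross u (y - x) = 0}" "closed {y. cross u (y - x) = 0}"
    "interior {y. cross u (y - x) = 0} = {}"
    unfolding eq using v by (simp_all add: convex_hyperplane closed_hyperplane interior_hyperplane)
qed

lemma open_Int_closure_nonempty:
  "open A \<Longrightarrow> x \<in> A \<Longrightarrow> x \<in> closure B \<Longrightarrow> A \<inter> B \<noteq> {}"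
  using open_Int_closure_eq_empty[of A B] by blast

lemma ex_component: "x \<in> S \<Longrightarrow> \<exists>C\<in>components S. x \<in> C"
  using Union_components[of S] by blast

section \<open>Pieces of one boundary inside the other region, and the cells they bound\<close>

locale polygon_pair = P: polygon vs n + Q: polygon ws m for vs n ws m
begin

abbreviation "cells \<equiv> components (P.reg \<inter> Q.reg)"

text \<open>The side is kept as a tag, which makes the total a plain sum over the sides. A vertex of
  the first polygon inside the second region lies on a piece of each of its two sides.\<close>

definition "pieces = (SIGMA i:{..<n}. components (P.edge i \<inter> Q.reg))"

text \<open>The closure is essential: a cell lies in the open first region and so is disjoint from
  every piece.\<close>

definition touches :: "complex set \<Rightarrow> nat \<times> complex set \<Rightarrow> bool" where
  "touches C p \<longleftrightarrow> snd p \<inter> closure C \<noteq> {}"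

lemma finite_pieces: "finite pieces" and card_pieces: "card pieces \<le> n * (m div 2)"
proof -
  have *: "finite (components (P.edge i \<inter> Q.reg)) \<and> card (components (P.edge i \<inter> Q.reg)) \<le> m div 2"
    if "i < n" for i
    unfolding P.edge_def by (intro Q.card_components_segment P.vertex_neq_next that)
  then show "finite pieces" by (auto simp: pieces_def)
  have "card pieces = (\<Sum>i<n. card (components (P.edge i \<inter> Q.reg)))"
    using * by (simp add: pieces_def)
  also have "\<dots> \<le> (\<Sum>i<n. m div 2)" using * by (intro sum_mono) auto
  finally show "card pieces \<le> n * (m div 2)" by simp
qed

lemma cell_props:
  assumes "C \<in> cells"
  shows "open C" "C \<noteq> {}" "C \<subseteq> P.reg" "C \<subseteq> Q.reg" "connected C"
proof -
  have "open (P.reg \<inter> Q.reg)" using P.Jordan(2) Q.Jordan(2) by (rule open_Int)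
  then show "open C" using assms by (rule open_components)
  show "C \<noteq> {}" "C \<subseteq> P.reg" "C \<subseteq> Q.reg" "connected C"
    using in_components_nonempty[OF assms] in_components_subset[OF assms]
      in_components_connected[OF assms] by simp_all
qed

lemma cells_eqI: "C \<in> cells \<Longrightarrow> C' \<in> cells \<Longrightarrow> C \<inter> C' \<noteq> {} \<Longrightarrow> C = C'"
  using components_nonoverlap[of C "P.reg \<inter> Q.reg" C'] by blast

text \<open>In a small ball inside the second region the first region is connected, hence contained
  in one cell. The right-hand side of the equivalence does not mention \<open>y\<close>: all
  boundary points of the ball are limits of the same cell.\<close>

lemma local_cell:
  assumes "x \<in> P.bd" "x \<in> Q.reg"
  obtains r where "0 < r" "P.reg \<inter> ball x r \<noteq> {}"
    "\<And>y C. y \<in> ball x r \<Longrightarrow> y \<in> P.bd \<Longrightarrow> C \<in> cells \<Longrightarrow> y \<in> closure C \<longleftrightarrow> P.reg \<inter> ball x r \<subseteq> C"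
proof -
  obtain r1 where r1: "0 < r1" "\<And>\<rho>. 0 < \<rho> \<Longrightarrow> \<rho> \<le> r1 \<Longrightarrow> connected (P.reg \<inter> ball x \<rho>)"
    by (rule P.local_connected[OF assms(1)]) (rule that)
  obtain r2 where r2: "0 < r2" "ball x r2 \<subseteq> Q.reg"
    using Q.Jordan(2) assms(2) by (meson open_contains_ball)
  define r where "r = min r1 r2"
  have r: "0 < r" "connected (P.reg \<inter> ball x r)" "ball x r \<subseteq> Q.reg"
    using r1 r2 by (auto simp: r_def)
  have cl: "y \<in> closure P.reg" if "y \<in> P.bd" for y
    using that P.Jordan(10) by (auto simp: frontier_def)
  show ?thesis
  proof (rule that[OF r(1)])
    show "P.reg \<inter> ball x r \<noteq> {}"
      using open_Int_closure_nonempty[OF open_ball _ cl[OF assms(1)]] r(1) by (simp add: Int_commute)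
  next
    fix y C assume y: "y \<in> ball x r" "y \<in> P.bd" and C: "C \<in> cells"
    note C' = cell_props[OF C]
    show "y \<in> closure C \<longleftrightarrow> P.reg \<inter> ball x r \<subseteq> C"
    proof
      assume "y \<in> closure C"
      then have "ball x r \<inter> C \<noteq> {}" using open_Int_closure_nonempty[OF open_ball y(1)] by blast
      then have "C \<inter> (P.reg \<inter> ball x r) \<noteq> {}" using C' by blast
      then show "P.reg \<inter> ball x r \<subseteq> C" using components_maximal[OF C r(2)] r(3) by blast
    next
      assume *: "P.reg \<inter> ball x r \<subseteq> C"
      have "y \<in> closure (ball x r \<inter> P.reg)"
        using open_Int_closure_subset[OF open_ball, of x r P.reg] cl[OF y(2)] y(1) by blast
      then show "y \<in> closure C" using * closure_mono[of "ball x r \<inter> P.reg" C] by blast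
    qed
  qed
qed

lemma piece_props:
  assumes "(i, I) \<in> pieces"
  shows "i < n" "I \<subseteq> P.edge i" "I \<subseteq> P.bd" "I \<subseteq> Q.reg" "connected I"
proof -
  have I: "i < n" "I \<in> components (P.edge i \<inter> Q.reg)" using assms by (auto simp: pieces_def)
  show "i < n" "I \<subseteq> P.edge i" "I \<subseteq> P.bd" "I \<subseteq> Q.reg" "connected I"
    using I in_components_subset[OF I(2)] in_components_connected[OF I(2)] by (auto simp: P.bd_eq)
qed

text \<open>Being a limit of the same cells is an equivalence relation that is locally constant on
  the piece by \<open>local_cell\<close>, so it is constant on the connected set \<open>I\<close>. A
  point that is a limit of both cells then has a nonempty common part of them nearby.\<close>

lemma touches_unique:
  assumes p: "p \<in> pieces" and C: "C \<in> cells" "C' \<in> cells" and t: "touches C p" "touches C' p"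
  shows "C = C'"
proof -
  obtain i I where [simp]: "p = (i, I)" by (cases p)
  note I = piece_props[of i I]
  obtain x y where xy: "x \<in> I" "x \<in> closure C" "y \<in> I" "y \<in> closure C'" using t by (auto simp: touches_def)
  define R where "R a b \<longleftrightarrow> (\<forall>D\<in>cells. a \<in> closure D \<longleftrightarrow> b \<in> closure D)" for a b
  have "R x y"
  proof (rule connected_equivalence_relation[of I])
    show "connected I" "x \<in> I" "y \<in> I" using I p xy by auto
    show "R b a" if "R a b" for a b using that by (auto simp: R_def)
    show "R a c" if "R a b" "R b c" for a b c using that by (auto simp: R_def)
    fix a assume a: "a \<in> I"
    then have "a \<in> P.bd" "a \<in> Q.reg" using I p by auto
    then obtain r where r: "0 < r" "\<And>y C. y \<in> ball a r \<Longrightarrow> y \<in> P.bd \<Longrightarrow> C \<in> cells \<Longrightarrow> y \<in> closure C \<longleftrightarrow> P.reg \<inter> ball a r \<subseteq> C"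
      by (rule local_cell) (rule that)
    have "\<forall>b\<in>I \<inter> ball a r. R a b"
      using r(2)[of a] r(2) r(1) a I p unfolding R_def by (simp add: subset_iff)
    then show "\<exists>T. openin (top_of_set I) T \<and> a \<in> T \<and> (\<forall>b\<in>T. R a b)"
      using a r(1) by (intro exI[of _ "I \<inter> ball a r"]) auto
  qed
  then have x: "x \<in> closure C'" using xy C by (auto simp: R_def)
  have "x \<in> P.bd" "x \<in> Q.reg" using I p xy by auto
  then obtain r where r: "0 < r" "P.reg \<inter> ball x r \<noteq> {}"
    "\<And>y C. y \<in> ball x r \<Longrightarrow> y \<in> P.bd \<Longrightarrow> C \<in> cells \<Longrightarrow> y \<in> closure C \<longleftrightarrow> P.reg \<inter> ball x r \<subseteq> C"
    by (rule local_cell) (rule that)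
  have "P.reg \<inter> ball x r \<subseteq> C" "P.reg \<inter> ball x r \<subseteq> C'"
    using r(3)[of x] r(1) xy x C \<open>x \<in> P.bd\<close> by auto
  then show ?thesis using r(2) cells_eqI[OF C] by blast
qed

text \<open>A frontier point of a cell cannot lie in both open regions, since the cell containing it
  would meet \<open>C\<close>. Inside the second region it must therefore lie on the first
  boundary.\<close>

lemma frontier_cell_touched:
  assumes C: "C \<in> cells" and x: "x \<in> frontier C" "x \<in> Q.reg"
  obtains i I where "(i, I) \<in> pieces" "x \<in> I" "touches C (i, I)"
proof -
  note C' = cell_props[OF C]
  have xc: "x \<in> closure C" "x \<notin> C" using x C'(1) by (auto simp: frontier_def interior_open)
  have "x \<notin> P.reg"
  proof
    assume "x \<in> P.reg"
    then obtain D where D: "D \<in> cells" "x \<in> D" using x(2) ex_component[of x "P.reg \<inter> Q.reg"] by blast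
    then have "D \<inter> C \<noteq> {}" using open_Int_closure_nonempty[OF cell_props(1)[OF D(1)] _ xc(1)] by blast
    then show False using cells_eqI[OF D(1) C] D xc by blast
  qed
  moreover have "x \<in> closure P.reg" using xc closure_mono[OF C'(3)] by auto
  ultimately have "x \<in> P.bd" using P.Jordan(2,10) by (auto simp: frontier_def interior_open)
  then obtain i where i: "i < n" "x \<in> P.edge i" by (auto simp: P.bd_eq)
  then obtain I where I: "I \<in> components (P.edge i \<inter> Q.reg)" "x \<in> I"
    using x(2) ex_component[of x "P.edge i \<inter> Q.reg"] by blast
  show ?thesis
  proof (rule that)
    show "(i, I) \<in> pieces" using i I by (simp add: pieces_def)
    show "x \<in> I" by fact
    then show "touches C (i, I)" using xc by (auto simp: touches_def)
  qed
qed

text \<open>The frontier of such a cell misses the connected second region, so the cell is all of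
  that region and leaves no room for another one.\<close>

lemma untouched_cell:
  assumes C: "C \<in> cells" and "\<And>p. p \<in> pieces \<Longrightarrow> \<not> touches C p"
  shows "cells = {C}"
proof -
  note C' = cell_props[OF C]
  have "Q.reg \<inter> frontier C = {}" using frontier_cell_touched[OF C] assms(2) by blast
  then have "Q.reg - C = {}"
    using connected_Int_frontier[OF Q.Jordan(3), of C] C' by blast
  then have "D = C" if "D \<in> cells" for D
    using cells_eqI[OF that C] cell_props[OF that] by auto
  then show ?thesis using C by blast
qed

text \<open>Each cell gets the vertex so obtained as its own, since two cells with the same vertex would overlap.
  Idea of the proof: an extreme point of the convex hull of the cell off the line of its only piece must be a vertex
  of the second polygon, and locally the whole second region belongs to the cell.\<close>

lemma cell_with_one_piece:
  assumes C: "C \<in> cells" and one: "{p \<in> pieces. touches C p} = {p}"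
  obtains j r where "j < m" "0 < r" "Q.reg \<inter> ball (ws ! j) r \<subseteq> C"
proof -
  note C' = cell_props[OF C]
  obtain i I where p: "p = (i, I)" by (cases p)
  have iI: "(i, I) \<in> pieces" using one p by auto
  note I = piece_props[OF iI]
  let ?u = "vs ! (Suc i mod n) - vs ! i"
  define l where "l = {y. cross ?u (y - vs ! i) = 0}"
  have "?u \<noteq> 0" using P.vertex_neq_next[OF I(1)] by auto
  note l = line_convex_closed[OF this, of "vs ! i", folded l_def]
  have edge_l: "P.edge i \<subseteq> l"
  proof
    fix y assume "y \<in> P.edge i"
    then obtain t where "y = vs ! i + t *\<^sub>R ?u"
      by (auto simp: P.edge_def closed_segment_def algebra_simps)
    then show "y \<in> l" by (simp add: l_def cross_scaleR_right cross_self)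
  qed
  \<comment> \<open>Every frontier point inside the second region lies on a touching piece, and the
    only one lies on the line \<open>l\<close>.\<close>
  have fr: "x \<in> l" if x: "x \<in> frontier C" "x \<in> Q.reg" for x
  proof -
    obtain i' I' where *: "(i', I') \<in> pieces" "x \<in> I'" "touches C (i', I')"
      by (rule frontier_cell_touched[OF C x]) (rule that)
    then have "(i', I') \<in> {p \<in> pieces. touches C p}" by auto
    then have "I' = I" using one p by auto
    then show ?thesis using * I edge_l by auto
  qed
  define K where "K = convex hull (closure C)"
  have "bounded C" using bounded_subset[OF Q.Jordan(6) C'(4)] .
  then have K: "compact K" "convex K" by (auto simp: K_def compact_convex_hull)
  have clK: "closure C \<subseteq> K" by (simp add: K_def hull_subset)
  then have CK: "C \<subseteq> K" using closure_subset by blast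
  \<comment> \<open>A compact convex set is the convex hull of its extreme points. If all of them
    lay on \<open>l\<close>, so would the nonempty open set \<open>C\<close>.\<close>
  have "\<exists>x. x extreme_point_of K \<and> x \<notin> l"
  proof (rule ccontr)
    assume "\<not> ?thesis"
    then have "convex hull {x. x extreme_point_of K} \<subseteq> l" using l(1) by (intro hull_minimal) auto
    then have "C \<subseteq> l" using Krein_Milman_Minkowski[OF K] CK by auto
    then have "C \<subseteq> interior l" using C'(1) by (rule interior_maximal)
    then show False using l(3) C'(2) by auto
  qed
  then obtain x where x: "x extreme_point_of K" "x \<notin> l" by auto
  have xcl: "x \<in> closure C" using x(1) unfolding K_def by (rule extreme_point_of_convex_hull)
  have "x \<notin> interior K" using x(1) by (rule extreme_point_not_in_interior)
  moreover have "C \<subseteq> interior K" using CK C'(1) by (rule interior_maximal)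
  ultimately have xC: "x \<notin> C" by auto
  then have xfr: "x \<in> frontier C" using xcl C'(1) by (auto simp: frontier_def interior_open)
  then have "x \<notin> Q.reg" using fr x(2) by auto
  moreover have "x \<in> closure Q.reg" using xcl closure_mono[OF C'(4)] by auto
  ultimately have xbd: "x \<in> Q.bd" using Q.Jordan(2,10) by (auto simp: frontier_def interior_open)
  obtain r1 where r1: "0 < r1" "\<And>\<rho>. 0 < \<rho> \<Longrightarrow> \<rho> \<le> r1 \<Longrightarrow> connected (Q.reg \<inter> ball x \<rho>)"
    by (rule Q.local_connected[OF xbd]) (rule that)
  obtain r2 where r2: "0 < r2" "ball x r2 \<subseteq> - l"
    using l(2) x(2) open_contains_ball[of "- l"] by auto
  \<comment> \<open>Away from \<open>l\<close> the second region contains no frontier point of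
    \<open>C\<close>; near \<open>x\<close> it is connected and meets \<open>C\<close>, so it stays
    in \<open>C\<close>.\<close>
  have sub: "Q.reg \<inter> ball x \<rho> \<subseteq> C" if "0 < \<rho>" "\<rho> \<le> min r1 r2" for \<rho>
  proof -
    have conn: "connected (Q.reg \<inter> ball x \<rho>)" using r1 that by auto
    have "ball x \<rho> \<subseteq> ball x r2" using that by auto
    then have "ball x \<rho> \<inter> l = {}" using r2(2) by blast
    then have "(Q.reg \<inter> ball x \<rho>) \<inter> frontier C = {}" using fr by blast
    moreover have "ball x \<rho> \<inter> C \<noteq> {}"
      using open_Int_closure_nonempty[OF open_ball _ xcl] that by simp
    ultimately have "(Q.reg \<inter> ball x \<rho>) - C = {}"
      using connected_Int_frontier[OF conn, of C] C'(4) by blast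
    then show ?thesis by auto
  qed
  define r where "r = min r1 r2"
  have r: "0 < r" using r1 r2 by (simp add: r_def)
  from xbd show ?thesis
  proof (cases rule: Q.bd_cases)
    case (vertex j)
    show ?thesis
    proof (rule that)
      show "Suc j mod m < m" using Q.k_ge3 by simp
      show "0 < r" by fact
      show "Q.reg \<inter> ball (ws ! (Suc j mod m)) r \<subseteq> C"
        using sub[of r] r unfolding vertex(2) by (simp add: r_def)
    qed
  next
    case (edge j)
    let ?w = "ws ! (Suc j mod m) - ws ! j"
    have w: "?w \<noteq> 0" using Q.vertex_neq_next[OF edge(1)] by auto
    obtain r3 where r3: "0 < r3" "\<And>y. y \<in> ball x r3 \<Longrightarrow> y \<in> Q.bd \<longleftrightarrow> cross ?w (y - x) = 0"
      by (rule Q.edge_local[OF edge]) (rule that)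
    define t where "t = min r r3 / (2 * norm ?w)"
    have t: "0 < t" "t * norm ?w < r" "t * norm ?w < r3"
      using r r3(1) w by (auto simp: t_def)
    \<comment> \<open>If \<open>x\<close> were not a vertex, its neighbours along the side in both
      directions would be limits of \<open>C\<close>, making \<open>x\<close> the midpoint of two
      points of \<open>K\<close>.\<close>
    have inK: "x + s *\<^sub>R ?w \<in> K" if s: "\<bar>s\<bar> = t" for s
    proof -
      have b: "x + s *\<^sub>R ?w \<in> ball x r" "x + s *\<^sub>R ?w \<in> ball x r3" using t s by (auto simp: dist_norm)
      then have "x + s *\<^sub>R ?w \<in> Q.bd" using r3(2)[OF b(2)] by (simp add: cross_scaleR_right cross_self)
      then have "x + s *\<^sub>R ?w \<in> closure Q.reg" using Q.Jordan(10) by (auto simp: frontier_def)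
      then have "x + s *\<^sub>R ?w \<in> closure (ball x r \<inter> Q.reg)"
        using open_Int_closure_subset[OF open_ball, of x r Q.reg] b by blast
      moreover have "ball x r \<inter> Q.reg \<subseteq> C" using sub[of r] r by (auto simp: r_def)
      ultimately show ?thesis using clK closure_mono by blast
    qed
    have "x \<in> open_segment (x + t *\<^sub>R ?w) (x + (- t) *\<^sub>R ?w)"
    proof -
      have "midpoint (x + t *\<^sub>R ?w) (x + (- t) *\<^sub>R ?w) = x" by (simp add: midpoint_eq_iff)
      moreover have "x + t *\<^sub>R ?w \<noteq> x + (- t) *\<^sub>R ?w"
      proof
        assume "x + t *\<^sub>R ?w = x + (- t) *\<^sub>R ?w"
        then have "t *\<^sub>R ?w = (- t) *\<^sub>R ?w" by (rule add_left_imp_eq)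
        then show False using t(1) w by (simp only: scaleR_cancel_right) auto
      qed
      ultimately show ?thesis
        using midpoint_in_open_segment[of "x + t *\<^sub>R ?w" "x + (- t) *\<^sub>R ?w"] by simp
    qed
    then have False using x(1) inK[of t] inK[of "- t"] t(1) unfolding extreme_point_of_def by auto
    then show ?thesis ..
  qed
qed

lemma cells_bound: "finite cells" "2 * card cells \<le> n * (m div 2) + m"
proof -
  let ?T = "\<lambda>C. {p \<in> pieces. touches C p}"
  have "finite cells \<and> 2 * card cells \<le> n * (m div 2) + m"
  proof (cases "\<exists>C\<in>cells. ?T C = {}")
    case True
    then obtain C where "cells = {C}" using untouched_cell by auto
    \<comment> \<open>Here there is a single cell, and \<open>m \<ge> 3\<close> already exceeds
      2.\<close>
    then show ?thesis using Q.k_ge3 by simp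
  next
    case False
    have finT: "finite (?T C)" for C using finite_pieces by simp
    have disj: "?T C \<inter> ?T D = {}" if "C \<in> cells" "D \<in> cells" "C \<noteq> D" for C D
      using touches_unique that by blast
    \<comment> \<open>Finiteness of the family of cells is not yet known. It follows because the
      sets of touching pieces are nonempty and disjoint, hence distinct subsets of a finite
      set.\<close>
    have "inj_on ?T cells"
    proof (rule inj_onI, rule ccontr)
      fix C D assume *: "C \<in> cells" "D \<in> cells" "?T C = ?T D" "C \<noteq> D"
      then have "?T C = {}" using disj[of C D] by auto
      then show False using False * by auto
    qed
    moreover have "?T ` cells \<subseteq> Pow pieces" by auto
    ultimately have fin: "finite cells" using finite_pieces by (meson finite_Pow_iff inj_on_finite)
    have "(\<Sum>C\<in>cells. card (?T C)) = card (\<Union>C\<in>cells. ?T C)"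
      using fin finT disj by (intro card_UN_disjoint[symmetric]) auto
    also have "\<dots> \<le> card pieces" using finite_pieces by (intro card_mono) auto
    finally have sum: "(\<Sum>C\<in>cells. card (?T C)) \<le> n * (m div 2)" using card_pieces by simp
    define ones where "ones = {C \<in> cells. card (?T C) = 1}"
    have "\<forall>C\<in>ones. \<exists>j. j < m \<and> (\<exists>r>0. Q.reg \<inter> ball (ws ! j) r \<subseteq> C)"
    proof
      fix C assume "C \<in> ones"
      then have C: "C \<in> cells" and c1: "card (?T C) = 1" by (auto simp: ones_def)
      from c1 obtain p where p: "?T C = {p}" by (auto simp: card_1_singleton_iff)
      obtain j r where "j < m" "0 < r" "Q.reg \<inter> ball (ws ! j) r \<subseteq> C"
        by (rule cell_with_one_piece[OF C p]) (rule that)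
      then show "\<exists>j. j < m \<and> (\<exists>r>0. Q.reg \<inter> ball (ws ! j) r \<subseteq> C)" by blast
    qed
    from bchoice[OF this] obtain j where j: "\<And>C. C \<in> ones \<Longrightarrow> j C < m"
      "\<And>C. C \<in> ones \<Longrightarrow> \<exists>r>0. Q.reg \<inter> ball (ws ! j C) r \<subseteq> C" by blast
    have "inj_on j ones"
    proof (rule inj_onI)
      fix C D assume CD: "C \<in> ones" "D \<in> ones" "j C = j D"
      obtain r s where rs: "0 < r" "Q.reg \<inter> ball (ws ! j C) r \<subseteq> C" "0 < s" "Q.reg \<inter> ball (ws ! j C) s \<subseteq> D"
        using j(2)[OF CD(1)] j(2)[OF CD(2)] CD(3) by auto
      have "ws ! j C \<in> Q.edge (j C)" by (simp add: Q.edge_def)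
      then have "ws ! j C \<in> Q.bd" using j(1)[OF CD(1)] by (auto simp: Q.bd_eq)
      then have "ws ! j C \<in> closure Q.reg" using Q.Jordan(10) by (auto simp: frontier_def)
      then have "ball (ws ! j C) (min r s) \<inter> Q.reg \<noteq> {}"
        using rs by (intro open_Int_closure_nonempty[of _ "ws ! j C"]) auto
      moreover have "ball (ws ! j C) (min r s) \<inter> Q.reg
          \<subseteq> (Q.reg \<inter> ball (ws ! j C) r) \<inter> (Q.reg \<inter> ball (ws ! j C) s)" by auto
      ultimately have "C \<inter> D \<noteq> {}" using rs(2,4) by blast
      then show "C = D" using cells_eqI CD by (auto simp: ones_def)
    qed
    then have "card ones \<le> card {..<m}" using j(1) by (intro card_inj_on_le[of j]) auto
    moreover have "2 * card cells \<le> (\<Sum>C\<in>cells. card (?T C)) + card ones"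
    proof -
      \<comment> \<open>A cell touched by one piece receives its second unit from its own vertex,
        counted by \<open>card ones\<close>.\<close>
      have "2 \<le> card (?T C) + (if C \<in> ones then 1 else 0)" if "C \<in> cells" for C
      proof -
        have "card (?T C) \<noteq> 0" using False that finT[of C] by simp
        then show ?thesis using that by (auto simp: ones_def)
      qed
      then have "(\<Sum>C\<in>cells. 2) \<le> (\<Sum>C\<in>cells. card (?T C) + (if C \<in> ones then 1 else 0))"
        by (intro sum_mono) auto
      also have "\<dots> = (\<Sum>C\<in>cells. card (?T C)) + card (cells \<inter> ones)"
        using fin by (simp add: sum.distrib sum.If_cases)
      also have "cells \<inter> ones = ones" by (auto simp: ones_def)
      finally show ?thesis by simp
    qed
    ultimately show ?thesis using fin sum by simp
  qed
  then show "finite cells" "2 * card cells \<le> n * (m div 2) + m" by auto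
qed

end


section \<open>Tools for constructions: monotone arcs and tests for inside and outside\<close>

lemma not_collinear_if_cross:
  assumes "cross (b - a) (c - a) \<noteq> 0"
  shows "\<not> collinear {a, b, c}"
proof
  assume "collinear {a, b, c}"
  then obtain u where u: "\<forall>x\<in>{a, b, c}. \<forall>y\<in>{a, b, c}. \<exists>t. x - y = t *\<^sub>R u"
    unfolding collinear_def by blast
  then obtain s t where "b - a = s *\<^sub>R u" "c - a = t *\<^sub>R u" by blast
  then show False using assms by (simp add: cross_simps)
qed

lemma path_image_increasing:
  assumes "sorted_wrt (\<lambda>a b. Re a < Re b) ws" "2 \<le> length ws" "y \<in> path_image (polygonal_path ws)"
  shows "y = hd ws \<or> Re (hd ws) < Re y"
proof -
  obtain i where i: "Suc i < length ws" "y \<in> closed_segment (ws ! i) (ws ! Suc i)"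
  proof -
    obtain i where "i < length ws - 1" "y \<in> closed_segment (ws ! i) (ws ! Suc i)"
      using assms(2,3) by (auto simp: path_image_polygonal_path)
    then show thesis using that[of i] assms(2) by simp
  qed
  have lt: "Re (ws ! i) < Re (ws ! Suc i)"
    using sorted_wrt_nth_less[OF assms(1), of i "Suc i"] i by auto
  obtain t where t: "0 \<le> t" "t \<le> 1" "y = ws ! i + t *\<^sub>R (ws ! Suc i - ws ! i)"
    using i(2) by (auto simp: closed_segment_def algebra_simps)
  have re: "Re y = Re (ws ! i) + t * (Re (ws ! Suc i) - Re (ws ! i))" using t by simp
  have hd: "hd ws = ws ! 0" using assms(2) by (cases ws) auto
  show ?thesis
  proof (cases "i = 0")
    case True
    then show ?thesis using t re lt hd by (cases "t = 0") auto
  next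
    case False
    then have "Re (ws ! 0) < Re (ws ! i)"
      using sorted_wrt_nth_less[OF assms(1), of 0 i] i by auto
    moreover have "0 \<le> t * (Re (ws ! Suc i) - Re (ws ! i))" using t lt by simp
    ultimately show ?thesis using re hd by simp
  qed
qed

text \<open>The first segment stays weakly to the left of \<open>b\<close> and the rest of the path,
  except for \<open>b\<close>, strictly to the right, so they share only \<open>b\<close>.\<close>

lemma arc_polygonal_path_increasing:
  "sorted_wrt (\<lambda>a b. Re a < Re b) ws \<Longrightarrow> 2 \<le> length ws \<Longrightarrow> arc (polygonal_path ws)"
proof (induction ws rule: polygonal_path.induct)
  case (3 a b)
  then have "a \<noteq> b" by auto
  then show ?case by (simp add: arc_linepath)
next
  case (4 a b c xs)
  have ab: "Re a < Re b" using 4 by simp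
  have "a \<noteq> b" using ab by auto
  have "closed_segment a b \<inter> path_image (polygonal_path (b # c # xs)) \<subseteq> {b}"
  proof
    fix y assume y: "y \<in> closed_segment a b \<inter> path_image (polygonal_path (b # c # xs))"
    then obtain t where "0 \<le> t" "t \<le> 1" "y = a + t *\<^sub>R (b - a)"
      by (auto simp: closed_segment_def algebra_simps)
    then have "Re y = Re a + t * (Re b - Re a)" "t * (Re b - Re a) \<le> 1 * (Re b - Re a)"
      using ab by (auto intro!: mult_right_mono)
    then have "\<not> Re b < Re y" by simp
    moreover have "y = hd (b # c # xs) \<or> Re (hd (b # c # xs)) < Re y"
      using y 4(2) by (intro path_image_increasing) auto
    ultimately show "y \<in> {b}" by simp
  qed
  then show ?case
    using 4 \<open>a \<noteq> b\<close> by (auto simp: arc_join_eq arc_linepath)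
qed auto

context polygon
begin

text \<open>A local certificate for lying inside. At the vertex \<open>x\<close> the direction
  \<open>b\<close> leaves the wedge between the two sides and is known to run in the exterior, so
  the wedge is the interior sector. The direction \<open>a\<close> points into the wedge, and
  \<open>A\<close> starts along it and never crosses the curve.\<close>

lemma wedge_in_reg:
  fixes i
  defines "x \<equiv> vs ! (Suc i mod k)"
  defines "d \<equiv> vs ! (Suc (Suc i) mod k) - x" and "e \<equiv> vs ! i - x"
  assumes i: "i < k"
    and a: "0 < cross a e / cross d e" "0 < cross d a / cross d e"
    and b: "cross b e / cross d e < 0 \<or> cross d b / cross d e < 0"
    and out: "\<And>t. 0 < t \<Longrightarrow> x + t *\<^sub>R b \<in> ext"
    and A: "connected A" "A \<inter> bd = {}" "\<And>t. 0 < t \<Longrightarrow> t < 1 \<Longrightarrow> x + t *\<^sub>R a \<in> A"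
  shows "A \<subseteq> reg"
proof -
  define h where "h y = min (cross (y - x) e / cross d e) (cross d (y - x) / cross d e)" for y
  obtain r s :: real where rs: "0 < r" "s = 1 \<or> s = -1"
    "\<And>y. y \<in> ball x r \<Longrightarrow> y \<in> reg \<longleftrightarrow> 0 < s * h y"
    "\<And>y. y \<in> ball x r \<Longrightarrow> y \<in> ext \<longleftrightarrow> s * h y < 0"
    by (rule vertex_sides[OF i, folded x_def, folded d_def e_def, folded h_def]) (rule that)
  have h: "h (x + t *\<^sub>R v) = t * min (cross v e / cross d e) (cross d v / cross d e)" if "0 < t" for t v
    using that by (simp add: h_def cross_scaleR_left cross_scaleR_right min_mult_distrib_left)
  define N where "N = norm a + norm b + 1"
  have N: "0 < N" "norm a < N" "norm b < N" by (auto simp: N_def add_nonneg_pos add_pos_nonneg)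
  have "0 < min 1 (r / N)" using rs(1) N(1) by simp
  then obtain t where t: "0 < t" "t < 1" "t < r / N" by (meson dense min_less_iff_conj)
  then have tN: "t * N < r" using N(1) by (simp add: pos_less_divide_eq)
  have inb: "x + t *\<^sub>R v \<in> ball x r" if "norm v < N" for v
  proof -
    have "t * norm v < r" using mult_strict_left_mono[OF that t(1)] tN by linarith
    then show ?thesis using t tN by (simp add: dist_norm)
  qed
  have "s * (t * min (cross b e / cross d e) (cross d b / cross d e)) < 0"
    using rs(4)[OF inb[OF N(3)]] out[OF t(1)] h[OF t(1)] by simp
  moreover have "t * min (cross b e / cross d e) (cross d b / cross d e) < 0"
    using b t(1) by (intro mult_pos_neg) (auto simp: min_less_iff_disj)
  \<comment> \<open>The exterior point in direction \<open>b\<close> has negative minimum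
    coordinate, which fixes the sign.\<close>
  ultimately have "s = 1" using rs(2) by auto
  moreover have "0 < t * min (cross a e / cross d e) (cross d a / cross d e)"
    using a t(1) by (intro mult_pos_pos) auto
  ultimately have "x + t *\<^sub>R a \<in> reg"
    using rs(3)[OF inb[OF N(2)]] h[OF t(1)] by simp
  then show ?thesis
    using connected_reg_or_ext[OF A(1,2)] A(3)[OF t(1,2)] Jordan(8) by blast
qed

lemma unbounded_connected_in_ext:
  assumes "connected A" "A \<inter> bd = {}" "\<not> bounded A"
  shows "A \<subseteq> ext"
  using connected_reg_or_ext[OF assms(1,2)] bounded_subset[OF Jordan(6)] assms(3) by blast

end

section \<open>Combs\<close>

text \<open>For an even number of vertices no direction points into all the teeth of the comb below, so the central
  line of the first tooth has to lean.\<close>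

definition slant :: "nat \<Rightarrow> real" where
  "slant i = (if i = 0 then 1/2 else 0)"

text \<open>The central line of a tooth, parametrized by height. The shift vanishes at height
  \<open>D\<close>, so it ends at the tip; the open range omits the tip itself, which lies on the
  boundary.\<close>

definition spine :: "real \<Rightarrow> nat \<Rightarrow> complex set" where
  "spine D i = (\<lambda>h. Complex (real i + slant i * (1 - h / D)) h) ` {0<..<D}"

lemma spineI:
  "0 < Im y \<Longrightarrow> Im y < D \<Longrightarrow> Re y = real i + slant i * (1 - Im y / D) \<Longrightarrow> y \<in> spine D i"
  unfolding spine_def by (rule image_eqI[of _ _ "Im y"]) (simp_all add: complex_eq_iff)

section \<open>A comb given by a sawtooth chain and one vertex far below\<close>

locale zigzag =
  fixes p :: nat and D :: real
  assumes p2: "2 \<le> p" and D_pos: "0 < D"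
begin

text \<open>The bottom height makes the closing side from \<open>vtx p\<close> to
  \<open>vtx 0\<close> have slope \<open>- 4 * D\<close>. This is steeper than the slope
  \<open>- 2 * D\<close> of the first spine, which in turn is steeper than the slope
  \<open>- D\<close> of the right flank of the first tooth.\<close>

definition vtx :: "nat \<Rightarrow> complex" where
  "vtx i = Complex (real i) (if i = p then - D * (4 * real p - 1) else if even i then D else 0)"

text \<open>The bottom vertex comes first, so that the path is one segment followed by an
  x-monotone arc.\<close>

definition zs :: "complex list" where
  "zs = vtx p # map vtx [0..<p]"

text \<open>The affine function that vanishes on the line of the closing side; it is positive at all
  other vertices.\<close>

definition closing :: "complex \<Rightarrow> real" where
  "closing y = Im y - D + 4 * D * Re y"

lemma Re_vtx [simp]: "Re (vtx i) = real i"
  by (simp add: vtx_def)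

lemma closing_vtx: "i < Suc p \<Longrightarrow> closing (vtx i) = 0 \<longleftrightarrow> i = 0 \<or> i = p" "i < Suc p \<Longrightarrow> 0 \<le> closing (vtx i)"
proof -
  have last: "closing (vtx p) = 0" using p2 by (simp add: closing_def vtx_def algebra_simps)
  have first: "closing (vtx 0) = 0" using p2 by (simp add: closing_def vtx_def)
  have mid: "0 < closing (vtx i)" if "0 < i" "i < p"
  proof -
    have "D * 1 \<le> D * real i" using D_pos that by (intro mult_left_mono) auto
    then have "D < 4 * D * real i" using D_pos by simp
    then show ?thesis using that D_pos by (simp add: closing_def vtx_def)
  qed
  show "i < Suc p \<Longrightarrow> closing (vtx i) = 0 \<longleftrightarrow> i = 0 \<or> i = p" "i < Suc p \<Longrightarrow> 0 \<le> closing (vtx i)"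
    using last first mid by (cases "i = 0"; cases "i = p"; force)+
qed

lemma closing_affine: "closing (a + t *\<^sub>R (b - a)) = (1 - t) * closing a + t * closing b"
  by (simp add: closing_def algebra_simps)

lemma cross_closing: "cross (vtx p - vtx 0) (y - vtx 0) = real p * closing y"
  using p2 by (simp add: cross_def closing_def vtx_def algebra_simps)

lemma segmentE:
  assumes "y \<in> closed_segment a b"
  obtains t where "0 \<le> t" "t \<le> 1" "y = a + t *\<^sub>R (b - a)"
  using assms by (auto simp: closed_segment_def algebra_simps)

lemma closing_segment: "y \<in> closed_segment (vtx p) (vtx 0) \<Longrightarrow> closing y = 0"
  using closing_vtx[of 0] closing_vtx[of p] p2 by (auto elim!: segmentE simp: closing_affine)

text \<open>\<open>closing\<close> is affine and nonnegative at both ends of the segment, so it can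
  vanish only at an end where it is zero. These ends are \<open>vtx 0\<close> and
  \<open>vtx p\<close>, which are not consecutive because \<open>p \<ge> 2\<close>.\<close>

lemma chain_closing:
  assumes "Suc i < Suc p" "y \<in> closed_segment (vtx i) (vtx (Suc i))" "closing y = 0"
  shows "y = vtx 0 \<or> y = vtx p"
proof -
  obtain t where t: "0 \<le> t" "t \<le> 1" "y = vtx i + t *\<^sub>R (vtx (Suc i) - vtx i)"
    using assms(2) by (rule segmentE)
  have eq: "(1 - t) * closing (vtx i) + t * closing (vtx (Suc i)) = 0"
    using assms(3) t(3) by (simp add: closing_affine)
  have nn: "0 \<le> (1 - t) * closing (vtx i)" "0 \<le> t * closing (vtx (Suc i))"
    using t closing_vtx(2) assms(1) by auto
  then have "(1 - t) * closing (vtx i) = 0" "t * closing (vtx (Suc i)) = 0" using eq by linarith+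
  then have "t = 1 \<or> closing (vtx i) = 0" "t = 0 \<or> closing (vtx (Suc i)) = 0" by auto
  moreover have "\<not> (closing (vtx i) = 0 \<and> closing (vtx (Suc i)) = 0)"
    using closing_vtx(1)[of i] closing_vtx(1)[of "Suc i"] assms(1) p2 by auto
  ultimately consider "t = 1" "closing (vtx (Suc i)) = 0" | "t = 0" "closing (vtx i) = 0" by auto
  then show ?thesis
    using closing_vtx(1)[of i] closing_vtx(1)[of "Suc i"] assms(1) t(3) by cases auto
qed

lemma nth_zs: "zs ! 0 = vtx p" "i < p \<Longrightarrow> zs ! Suc i = vtx i" "length zs = Suc p"
  using p2 by (auto simp: zs_def)

lemma nth_zs_Suc: "i < Suc p \<Longrightarrow> zs ! (Suc i mod Suc p) = vtx i"
  using p2 nth_zs by (cases "i = p") auto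

lemma closed_path_zs: "closed_polygon_path zs = linepath (vtx p) (vtx 0) +++ polygonal_path (map vtx [0..<Suc p])"
proof -
  have "closed_polygon_path zs = polygonal_path (vtx p # map vtx [0..<Suc p])"
    by (simp add: closed_polygon_path_def zs_def)
  also have "\<dots> = linepath (vtx p) (hd (map vtx [0..<Suc p])) +++ polygonal_path (map vtx [0..<Suc p])"
    using p2 by (intro polygonal_path_Cons) (auto simp: upt_conv_Cons)
  finally show ?thesis using p2 by (simp add: upt_conv_Cons)
qed

lemma simple_path_zs: "simple_path (closed_polygon_path zs)"
  unfolding closed_path_zs
proof (rule simple_path_join_loop)
  have "vtx p \<noteq> vtx 0" using p2 by (auto simp: complex_eq_iff)
  then show "arc (linepath (vtx p) (vtx 0))" by (simp add: arc_linepath)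
  show "arc (polygonal_path (map vtx [0..<Suc p]))"
    using p2 by (intro arc_polygonal_path_increasing) (simp_all add: sorted_wrt_map del: upt_Suc)
  have ne: "map vtx [0..<Suc p] \<noteq> []" "hd (map vtx [0..<Suc p]) = vtx 0" "last (map vtx [0..<Suc p]) = vtx p"
    using p2 by (auto simp: upt_conv_Cons last_map)
  show "pathfinish (linepath (vtx p) (vtx 0)) = pathstart (polygonal_path (map vtx [0..<Suc p]))"
    "pathfinish (polygonal_path (map vtx [0..<Suc p])) = pathstart (linepath (vtx p) (vtx 0))"
    using ne by simp_all
  have "path_image (polygonal_path (map vtx [0..<Suc p])) = (\<Union>i<p. closed_segment (vtx i) (vtx (Suc i)))"
    using p2 by (subst path_image_polygonal_path) (auto simp del: upt_Suc intro!: SUP_cong)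
  then show "path_image (linepath (vtx p) (vtx 0)) \<inter> path_image (polygonal_path (map vtx [0..<Suc p]))
      \<subseteq> {pathstart (linepath (vtx p) (vtx 0)), pathstart (polygonal_path (map vtx [0..<Suc p]))}"
    using ne closing_segment chain_closing by fastforce
qed

lemma noncollinear_chain:
  assumes "Suc (Suc i) < Suc p"
  shows "\<not> collinear {vtx i, vtx (Suc i), vtx (Suc (Suc i))}"
proof (rule not_collinear_if_cross)
  have "0 < D * (1 + real i)" using D_pos by (simp add: add_pos_nonneg)
  then show "cross (vtx (Suc i) - vtx i) (vtx (Suc (Suc i)) - vtx i) \<noteq> 0"
    using assms D_pos by (cases "Suc (Suc i) = p") (auto simp: cross_def vtx_def algebra_simps)
qed

lemma noncollinear_closing:
  assumes "0 < i" "i < p"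
  shows "\<not> collinear {vtx 0, vtx p, vtx i}"
proof (rule not_collinear_if_cross)
  show "cross (vtx p - vtx 0) (vtx i - vtx 0) \<noteq> 0"
    unfolding cross_closing using assms closing_vtx(1)[of i] by simp
qed

lemma is_kgon_zs: "is_kgon (Suc p) zs"
  unfolding is_kgon_def
proof (intro conjI allI impI)
  show "length zs = Suc p" by (rule nth_zs)
  show "3 \<le> Suc p" using p2 by simp
  show "simple_path (closed_polygon_path zs)" by (rule simple_path_zs)
  fix i assume i: "i < Suc p"
  have s: "(i + 2) mod Suc p = Suc (Suc i mod Suc p) mod Suc p" by (simp add: mod_Suc_eq)
  show "\<not> collinear {zs ! i, zs ! ((i + 1) mod Suc p), zs ! ((i + 2) mod Suc p)}"
  proof (cases i)
    case 0
    have "zs ! (Suc (Suc 0) mod Suc p) = vtx 1" using nth_zs_Suc[of 1] p2 by simp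
    then show ?thesis
      using noncollinear_closing[of 1] p2 0 nth_zs_Suc[of 0]
      by (simp add: nth_zs insert_commute numeral_2_eq_2)
  next
    case (Suc j)
    have zi: "zs ! i = vtx j" "zs ! ((i + 1) mod Suc p) = vtx i" using Suc i nth_zs_Suc[of i] nth_zs(2)[of j] by auto
    show ?thesis
    proof (cases "Suc i = Suc p")
      case True
      then have "zs ! ((i + 2) mod Suc p) = vtx 0" using s nth_zs_Suc[of 0] p2 by simp
      moreover have "i = p" "j < p" "0 < j" using True Suc p2 by auto
      ultimately show ?thesis using noncollinear_closing[of j] zi by (simp add: insert_commute)
    next
      case False
      then have "zs ! ((i + 2) mod Suc p) = vtx (Suc i)" using s nth_zs_Suc[of "Suc i"] i by simp
      then show ?thesis using noncollinear_chain[of j] zi Suc False i by simp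
    qed
  qed
qed

sublocale polygon zs "Suc p"
  by (unfold_locales) (rule is_kgon_zs)

lemma bd_zs: "bd = closed_segment (vtx p) (vtx 0) \<union> (\<Union>i<p. closed_segment (vtx i) (vtx (Suc i)))"
proof -
  have "{..<Suc p} = insert 0 (Suc ` {..<p})" using p2 lessThan_Suc_eq_insert_0[of p] by simp
  moreover have "edge 0 = closed_segment (vtx p) (vtx 0)"
    using nth_zs_Suc[of 0] p2 by (simp add: edge_def nth_zs)
  moreover have "edge (Suc i) = closed_segment (vtx i) (vtx (Suc i))" if "i < p" for i
    using nth_zs_Suc[of "Suc i"] that by (simp add: edge_def nth_zs)
  ultimately show ?thesis by (simp add: bd_eq)
qed

lemma bd_cases_zs:
  assumes "y \<in> bd"
  obtains "closing y = 0" | i t where "Suc i < Suc p" "0 \<le> t" "t \<le> 1" "y = vtx i + t *\<^sub>R (vtx (Suc i) - vtx i)"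
proof -
  from assms consider "y \<in> closed_segment (vtx p) (vtx 0)"
    | i where "i < p" "y \<in> closed_segment (vtx i) (vtx (Suc i))"
    unfolding bd_zs by blast
  then show ?thesis
  proof cases
    case 1
    then show ?thesis using that(1) closing_segment by blast
  next
    case 2
    obtain t where "0 \<le> t" "t \<le> 1" "y = vtx i + t *\<^sub>R (vtx (Suc i) - vtx i)"
      using 2(2) by (rule segmentE)
    then show ?thesis using that(2)[of i t] 2(1) by simp
  qed
qed

text \<open>Each side of the sawtooth chain runs from one integer column to the next, so it meets
  such a column only in a vertex.\<close>

lemma bd_at_integer:
  assumes "y \<in> bd" "Re y = real i"
  shows "closing y = 0 \<or> y = vtx i"
  using assms(1)
proof (cases rule: bd_cases_zs)
  case (2 j t)
  then have "real i = real j + t" using assms(2) by simp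
  moreover from this have "real j \<le> real i" "real i \<le> real (Suc j)" using 2(2,3) by simp_all
  then have "i = j \<or> i = Suc j" by linarith
  ultimately have "i = j \<and> t = 0 \<or> i = Suc j \<and> t = 1" by auto
  then show ?thesis using 2 by auto
qed auto

lemma unbounded_ray: "\<not> bounded {y. Re y = c \<and> h < Im y}"
proof
  assume "bounded {y. Re y = c \<and> h < Im y}"
  then obtain B where B: "\<And>y. Re y = c \<Longrightarrow> h < Im y \<Longrightarrow> norm y \<le> B" by (auto simp: bounded_iff)
  have "\<bar>h\<bar> + \<bar>B\<bar> + 1 \<le> norm (Complex c (\<bar>h\<bar> + \<bar>B\<bar> + 1))" using abs_Im_le_cmod[of "Complex c (\<bar>h\<bar> + \<bar>B\<bar> + 1)"] by simp
  also have "\<dots> \<le> B" by (rule B) auto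
  finally show False by simp
qed

lemma connected_ray: "connected {y. Re y = c \<and> h < Im y}"
proof -
  have "{y. Re y = c \<and> h < Im y} = Complex c ` {h<..}"
    by (auto simp: image_def complex_eq_iff)
  moreover have "continuous_on {h<..} (Complex c)" unfolding Complex_eq by (intro continuous_intros)
  ultimately show ?thesis by (simp add: connected_continuous_image)
qed

lemma ray_in_ext:
  assumes "\<And>y. y \<in> bd \<Longrightarrow> Re y = c \<Longrightarrow> Im y \<le> h"
  shows "{y. Re y = c \<and> h < Im y} \<subseteq> ext"
  using assms by (intro unbounded_connected_in_ext connected_ray unbounded_ray) force

text \<open>On an odd column the boundary consists at most of the valley at height 0 and a point of
  the closing line below it, so the upward ray from the valley runs in the exterior. These columns
  later separate the teeth, because the other comb lies strictly above height 0.\<close>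

lemma gap:
  assumes "odd i" "i < p" "Re y = real i" "y \<in> reg"
  shows "Im y \<le> 0"
proof (rule ccontr)
  assume "\<not> Im y \<le> 0"
  have "{y. Re y = real i \<and> 0 < Im y} \<subseteq> ext"
  proof (rule ray_in_ext)
    fix y assume "y \<in> bd" "Re y = real i"
    moreover have "D * 1 \<le> D * real i" using D_pos assms(1) by (intro mult_left_mono) (auto elim: oddE)
    then have "D \<le> 4 * D * real i" using D_pos by simp
    ultimately show "Im y \<le> 0"
      using bd_at_integer[of y i] assms(1,2) by (auto simp: vtx_def closing_def)
  qed
  then show False using assms(3,4) \<open>\<not> Im y \<le> 0\<close> Jordan(8) by force
qed

lemma spine_bd:
  assumes "even i" "i < p"
  shows "spine D i \<inter> bd = {}"
proof -
  have False if y: "y \<in> spine D i" "y \<in> bd" for y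
  proof -
    have im: "0 < Im y" "Im y < D" and re: "Re y = real i + slant i * (1 - Im y / D)"
      using y(1) by (auto simp: spine_def)
    have q: "0 < Im y / D" "Im y / D < 1" using im D_pos by auto
    show False
    proof (cases "i = 0")
      case False
      then have "Re y = real i" using re by (simp add: slant_def)
      moreover have "0 < Im y + D * (4 * real i - 1)"
        using False D_pos im by (intro add_pos_nonneg mult_nonneg_nonneg) auto
      ultimately have "closing y \<noteq> 0" by (simp add: closing_def algebra_simps)
      then show ?thesis
        using bd_at_integer[OF y(2), of i] \<open>Re y = real i\<close> im assms by (auto simp: vtx_def)
    next
      case True
      then have re: "Re y = (1 - Im y / D) / 2" using re by (simp add: slant_def)
      \<comment> \<open>On the closing line \<open>4 * D * Re y\<close> equals
        \<open>D - Im y\<close>, and on the right flank \<open>D * Re y\<close> does. Either is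
        compatible with this equation only at the tip, where \<open>Im y = D\<close>.\<close>
      then have Dre: "2 * D * Re y = D - Im y" using D_pos by (simp add: field_simps)
      from y(2) show ?thesis
      proof (cases rule: bd_cases_zs)
        case 1
        then show ?thesis using Dre im by (simp add: closing_def)
      next
        case (2 j t)
        then have "Re y = real j + t" by simp
        then have "real j < 1" using re q 2(2) by simp
        then have j: "j = 0" by simp
        then have "Re y = t" "Im y = D - t * D"
          using p2 unfolding 2(4) by (auto simp: vtx_def algebra_simps)
        then show ?thesis using Dre im D_pos by auto
      qed
    qed
  qed
  then show ?thesis by blast
qed

text \<open>The certificate \<open>wedge_in_reg\<close> is applied at the tip of the tooth:
  \<open>a\<close> runs down the spine, and the exterior direction is straight up.\<close>

lemma spine_in_reg:
  assumes "even i" "i < p"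
  shows "spine D i \<subseteq> reg"
proof -
  define e where "e = zs ! i - vtx i"
  define d where "d = vtx (Suc i) - vtx i"
  define a where "a = Complex (slant i) (- D)"
  have xi: "zs ! (Suc i mod Suc p) = vtx i" "zs ! (Suc (Suc i) mod Suc p) = vtx (Suc i)"
    using nth_zs_Suc[of i] nth_zs_Suc[of "Suc i"] assms by auto
  \<comment> \<open>The case \<open>Suc i = p\<close> is a last tooth whose right flank drops
    directly to the bottom vertex.\<close>
  have dD: "d = Complex 1 (if Suc i = p then - D * (4 * real p) else - D)"
    using assms p2 by (auto simp: d_def vtx_def complex_eq_iff algebra_simps)
  have n1: "0 < real p" "0 < D * real p" using p2 D_pos by auto
  have signs: "0 < cross a e / cross d e" "0 < cross d a / cross d e"
    "cross \<i> e / cross d e < 0 \<or> cross d \<i> / cross d e < 0"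
  proof -
    have "0 < cross a e / cross d e \<and> 0 < cross d a / cross d e \<and>
      (cross \<i> e / cross d e < 0 \<or> cross d \<i> / cross d e < 0)"
    proof (cases "i = 0")
      case True
      have e0: "e = Complex (real p) (- 4 * D * real p)"
        using True p2 by (simp add: e_def nth_zs vtx_def complex_eq_iff algebra_simps)
      have d0: "d = Complex 1 (- D)" using dD True p2 by auto
      have a0: "a = Complex (1/2) (- D)" using True by (simp add: a_def slant_def)
      have "cross d e = - 3 * (D * real p)" "cross a e = - (D * real p)"
        "cross d a = - D / 2" "cross d \<i> = 1"
        unfolding e0 d0 a0 by (simp_all add: cross_def algebra_simps)
      then show ?thesis using n1 D_pos by (auto simp: divide_simps)
    next
      case False
      then obtain j where j: "i = Suc j" by (cases i) auto
      have e0: "e = Complex (- 1) (- D)"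
        using j assms p2 by (auto simp: e_def nth_zs vtx_def complex_eq_iff)
      have a0: "a = Complex 0 (- D)" using False by (simp add: a_def slant_def)
      obtain \<delta> where \<delta>: "d = Complex 1 (- \<delta>)" "0 < \<delta>"
        using dD n1 D_pos p2 by (cases "Suc i = p") auto
      have "cross d e = - (D + \<delta>)" "cross a e = - D" "cross d a = - D" "cross \<i> e = 1"
        unfolding e0 a0 \<delta>(1) by (simp_all add: cross_def algebra_simps)
      then show ?thesis using \<delta>(2) D_pos by (auto simp: divide_simps)
    qed
    then show "0 < cross a e / cross d e" "0 < cross d a / cross d e"
    "cross \<i> e / cross d e < 0 \<or> cross d \<i> / cross d e < 0" by auto
  qed
  have up: "vtx i + t *\<^sub>R \<i> \<in> ext" if "0 < t" for t
  proof -
    have "{y. Re y = real i \<and> D < Im y} \<subseteq> ext"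
    proof (rule ray_in_ext)
      fix y assume "y \<in> bd" "Re y = real i"
      moreover have "0 \<le> D * real i" using D_pos by simp
      ultimately show "Im y \<le> D"
        using bd_at_integer[of y i] assms by (auto simp: vtx_def closing_def)
    qed
    moreover have "Im (vtx i) = D" using assms by (simp add: vtx_def)
    ultimately show ?thesis using that by auto
  qed
  have conn: "connected (spine D i)"
    unfolding spine_def Complex_eq by (intro connected_continuous_image continuous_intros) (use D_pos in auto)
  have near: "vtx i + t *\<^sub>R a \<in> spine D i" if "0 < t" "t < 1" for t
  proof -
    have eq: "(1 - t) * D / D = 1 - t" using D_pos by simp
    have "vtx i + t *\<^sub>R a = Complex (real i + slant i * (1 - (1 - t) * D / D)) ((1 - t) * D)"
      unfolding eq using assms by (simp add: a_def vtx_def complex_eq_iff algebra_simps)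
    moreover have "(1 - t) * D \<in> {0<..<D}" using that D_pos by (simp add: mult_less_cancel_right1)
    ultimately show ?thesis unfolding spine_def by blast
  qed
  show ?thesis
  proof (rule wedge_in_reg[of i, unfolded xi, folded d_def e_def])
    show "i < Suc p" using assms by simp
  qed (use signs up conn spine_bd[OF assms] near in auto)
qed

text \<open>The exterior contains the complement of a convex set around the curve. Openness of the
  region makes the bounds strict, and this strictness is what contradicts \<open>gap\<close> in the
  crossed combs.\<close>

lemma reg_Re:
  assumes "y \<in> reg"
  shows "0 < Re y" "Re y < real p"
proof -
  let ?T = "{y. 0 \<le> Re y} \<inter> {y. Re y \<le> real p}"
  have conv: "convex ?T" by (intro convex_Int convex_halfspace_Re_ge convex_halfspace_Re_le)
  have "vtx i \<in> ?T" if "i < Suc p" for i using that p2 by auto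
  then have "bd \<subseteq> ?T" unfolding bd_zs using p2
    by (intro Un_least UN_least closed_segment_subset conv) auto
  then have "- ?T \<subseteq> ext" unfolding ext_def using conv by (intro outside_subset_convex)
  then have T: "reg \<subseteq> ?T" using Jordan(8) by blast
  obtain r where r: "0 < r" "ball y r \<subseteq> reg" using Jordan(2) assms by (meson open_contains_ball)
  have "y - of_real (r / 2) \<in> ball y r" "y + of_real (r / 2) \<in> ball y r"
    using r(1) by (auto simp: dist_norm)
  then have "y - of_real (r / 2) \<in> ?T" "y + of_real (r / 2) \<in> ?T" using r(2) T by blast+
  then show "0 < Re y" "Re y < real p" using r(1) by auto
qed

end

section \<open>Two crossed combs\<close>

text \<open>Reflection in the diagonal: it turns upright teeth into horizontal ones, keeps the first
  quadrant, and is its own inverse.\<close>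

definition flip :: "complex \<Rightarrow> complex" where
  "flip y = Complex (Im y) (Re y)"

lemma flip_simps [simp]: "Re (flip y) = Im y" "Im (flip y) = Re y" "flip (flip y) = y"
  by (simp_all add: flip_def)

lemma linear_flip: "linear flip"
  by (rule linearI) (simp_all add: flip_def complex_eq_iff)

lemma inj_flip: "inj flip"
  by (metis flip_simps(3) injI)

lemma continuous_on_flip: "continuous_on A flip"
  unfolding flip_def[abs_def] Complex_eq by (intro continuous_intros)

lemma bounded_flip_image: "bounded (flip ` A) \<longleftrightarrow> bounded A"
proof -
  have "bounded (flip ` B)" if "bounded B" for B
    using that linear_flip by (intro bounded_linear_image) (simp_all add: linear_conv_bounded_linear)
  from this[of A] this[of "flip ` A"] show ?thesis by (auto simp: image_image)
qed

lemma polygonal_path_linear: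
  assumes "linear f"
  shows "polygonal_path (map f ws) = f \<circ> polygonal_path ws"
proof -
  have line: "linepath (f a) (f b) = f \<circ> linepath a b" for a b
    using assms by (auto simp: linepath_def linear_add linear_scale)
  show ?thesis
  proof (induction ws rule: polygonal_path.induct)
    case 1
    show ?case using line[of 0 0] by (simp add: linear_0[OF assms])
  qed (simp_all add: line path_compose_join, simp add: comp_def)
qed

lemma closed_polygon_path_flip:
  assumes "vs \<noteq> []"
  shows "closed_polygon_path (map flip vs) = flip \<circ> closed_polygon_path vs"
  using assms polygonal_path_linear[OF linear_flip, of "vs @ [hd vs]"]
  by (simp add: closed_polygon_path_def hd_map)

lemma cross_flip: "cross (flip a - flip b) (flip c - flip d) = - cross (a - b) (c - d)"
  by (simp add: cross_def)

lemma is_kgon_flip: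
  assumes "is_kgon k vs"
  shows "is_kgon k (map flip vs)"
proof -
  interpret polygon vs k by unfold_locales (rule assms)
  have "vs \<noteq> []" using length_vs k_ge3 by auto
  have "\<not> collinear {flip (vs ! i), flip (vs ! (Suc i mod k)), flip (vs ! (Suc (Suc i) mod k))}" if "i < k" for i
  proof -
    have "cross (vs ! (Suc (Suc i) mod k) - vs ! (Suc i mod k)) (vs ! i - vs ! (Suc i mod k)) \<noteq> 0"
      using noncollinear[OF that] by (rule cross_neq_0_if_not_collinear)
    then have "\<not> collinear {flip (vs ! (Suc i mod k)), flip (vs ! (Suc (Suc i) mod k)), flip (vs ! i)}"
      by (intro not_collinear_if_cross) (simp only: cross_flip neg_equal_0_iff_equal not_False_eq_True)
    then show ?thesis by (simp add: insert_commute)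
  qed
  moreover have "Suc i mod k < k" "Suc (Suc i) mod k < k" for i using k_ge3 by simp_all
  ultimately show ?thesis
    using length_vs k_ge3 simple \<open>vs \<noteq> []\<close>
    by (simp add: is_kgon_def closed_polygon_path_flip simple_path_linear_image_eq[OF linear_flip inj_flip])
qed

text \<open>The image of the exterior is connected and unbounded, hence exterior. The image of the
  interior is connected, and it cannot be exterior as well, because the two images fill the
  complement of the reflected curve.\<close>

lemma inside_flip:
  assumes "is_kgon k vs"
  shows "inside (path_image (closed_polygon_path (map flip vs))) = flip ` inside (path_image (closed_polygon_path vs))"
proof -
  interpret A: polygon vs k by unfold_locales (rule assms)
  interpret B: polygon "map flip vs" k by unfold_locales (rule is_kgon_flip[OF assms])
  have "vs \<noteq> []" using A.length_vs A.k_ge3 by auto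
  then have bd: "B.bd = flip ` A.bd"
    by (simp add: A.bd_def B.bd_def closed_polygon_path_flip path_image_compose)
  have disj: "flip ` S \<inter> flip ` T = {}" if "S \<inter> T = {}" for S T
    using that image_Int[OF inj_flip, of S T] by simp
  have ext: "flip ` A.ext \<subseteq> B.ext"
  proof (rule B.unbounded_connected_in_ext)
    show "connected (flip ` A.ext)" using A.Jordan(5) by (intro connected_continuous_image continuous_on_flip)
    show "flip ` A.ext \<inter> B.bd = {}" unfolding bd using A.Jordan(9) by (intro disj) auto
    show "\<not> bounded (flip ` A.ext)" using A.Jordan(7) by (simp add: bounded_flip_image)
  qed
  have reg: "flip ` A.reg \<subseteq> B.reg \<or> flip ` A.reg \<subseteq> B.ext"
  proof (rule B.connected_reg_or_ext)
    show "connected (flip ` A.reg)" using A.Jordan(3) by (intro connected_continuous_image continuous_on_flip)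
    show "flip ` A.reg \<inter> B.bd = {}" unfolding bd using A.Jordan(9) by (intro disj) auto
  qed
  have all: "flip ` A.reg \<union> flip ` A.ext = B.reg \<union> B.ext"
  proof -
    have "flip ` A.reg \<union> flip ` A.ext = flip ` (- A.bd)" using A.Jordan(9) by (simp flip: image_Un)
    also have "\<dots> = - flip ` A.bd"
      by (rule bij_image_Compl_eq) (use inj_flip in \<open>auto simp: bij_def surj_def intro: exI[of _ "flip _"]\<close>)
    also have "\<dots> = B.reg \<union> B.ext" using B.Jordan(9) bd by simp
    finally show ?thesis .
  qed
  have "\<not> flip ` A.reg \<subseteq> B.ext"
  proof
    assume "flip ` A.reg \<subseteq> B.ext"
    then have "B.reg \<subseteq> B.ext" using ext all by blast
    then show False using B.Jordan(1,8) by blast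
  qed
  then have "flip ` A.reg \<subseteq> B.reg" using reg by blast
  moreover have "B.reg \<subseteq> flip ` A.reg"
  proof
    fix y assume y: "y \<in> B.reg"
    then have "y \<in> flip ` A.reg \<union> flip ` A.ext" unfolding all by simp
    moreover have "y \<notin> flip ` A.ext" using y ext B.Jordan(8) by blast
    ultimately show "y \<in> flip ` A.reg" by blast
  qed
  ultimately have "flip ` A.reg = B.reg" by (rule equalityI)
  then show ?thesis by (simp add: A.reg_def B.reg_def A.bd_def B.bd_def)
qed

text \<open>Two linear equations in the coordinates \<open>x\<close> and \<open>h\<close> of the
  crossing. The bounds on \<open>D\<close> make the combs higher than they are wide, so that the
  solution lies within the open range of both spines.\<close>

lemma spines_meet:
  fixes i j :: nat and D :: real
  assumes "0 < D" "real i + 1 \<le> D" "real j + 1 \<le> D"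
  obtains y where "y \<in> spine D i" "flip y \<in> spine D j"
proof -
  define \<kappa> \<mu> den where "\<kappa> = slant i / D" and "\<mu> = slant j / D" and "den = 1 - \<kappa> * \<mu>"
  \<comment> \<open>Cramer's rule for \<open>x + \<kappa> * h = real i + slant i\<close> and
    \<open>h + \<mu> * x = real j + slant j\<close>, with determinant \<open>den\<close>.\<close>
  define x h where "x = (real i + slant i - \<kappa> * (real j + slant j)) / den"
    and "h = (real j + slant j - \<mu> * (real i + slant i)) / den"
  have small: "0 \<le> slant k / D" "slant k / D \<le> 1 / 2" for k
    using assms by (auto simp: slant_def field_simps)
  have less: "real k + slant k < D" if "real k + 1 \<le> D" for k
    using that by (auto simp: slant_def)
  have num: "0 < real k + slant k - slant k / D * (real l + slant l)" if "real l + 1 \<le> D" for k l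
  proof (cases "k = 0")
    case True
    then have "slant k = 1 / 2" by (simp add: slant_def)
    then show ?thesis using less[OF that] assms(1) by (simp only: True of_nat_0) (simp add: field_simps)
  qed (simp add: slant_def)
  have "\<kappa> * \<mu> \<le> 1 / 2 * (1 / 2)"
    unfolding \<kappa>_def \<mu>_def using small by (intro mult_mono) auto
  then have den: "0 < den" by (simp add: den_def)
  have pos: "0 < x" "0 < h"
    using num[OF assms(3)] num[OF assms(2)] den by (auto simp: x_def h_def \<kappa>_def \<mu>_def)
  have dx: "den * x = real i + slant i - \<kappa> * (real j + slant j)"
    and dh: "den * h = real j + slant j - \<mu> * (real i + slant i)"
    using den by (simp_all add: x_def h_def)
  have "den * (x + \<kappa> * h) = den * (real i + slant i)"
    using dx dh by (simp add: distrib_left mult.left_commute[of den]) (simp add: den_def algebra_simps)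
  then have x: "x + \<kappa> * h = real i + slant i" using den by simp
  have "den * (h + \<mu> * x) = den * (real j + slant j)"
    using dx dh by (simp add: distrib_left mult.left_commute[of den]) (simp add: den_def algebra_simps)
  then have h: "h + \<mu> * x = real j + slant j" using den by simp
  have "0 \<le> \<kappa> * h" "0 \<le> \<mu> * x" 
    using small(1) pos unfolding \<kappa>_def \<mu>_def by (intro mult_nonneg_nonneg less_imp_le[OF pos(2)] less_imp_le[OF pos(1)] small(1))+
  then have "x < D" "h < D" using x h less[OF assms(2)] less[OF assms(3)] by linarith+
  have xh: "x = real i + slant i * (1 - h / D)" and hx: "h = real j + slant j * (1 - x / D)"
    using x h by (simp_all add: \<kappa>_def \<mu>_def algebra_simps)
  show ?thesis
  proof (rule that)
    show "Complex x h \<in> spine D i"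
      by (rule spineI; unfold complex.sel) (rule pos \<open>h < D\<close> xh)+
    show "flip (Complex x h) \<in> spine D j"
      by (rule spineI; unfold flip_simps complex.sel) (rule pos \<open>x < D\<close> hx)+
  qed
qed

text \<open>One cell is found for each pair of teeth, at the crossing of their spines. Different
  pairs give different cells: on an odd column the first comb lies at height at most 0 and the
  second strictly above, and odd rows separate in the same way with the roles exchanged.\<close>

lemma many_cells:
  fixes p q :: nat
  assumes "2 \<le> q" "q \<le> p"
  obtains P Q where "kgon_region (Suc p) P" "kgon_region (Suc q) Q" "finite (components (P \<inter> Q))"
    "(Suc q div 2) * (Suc p div 2) \<le> card (components (P \<inter> Q))"
proof -
  \<comment> \<open>One common height for both combs, larger than every tooth position of either
    since \<open>q \<le> p\<close>.\<close>
  define D where "D = real p + 1"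
  interpret P: zigzag p D using assms by unfold_locales (auto simp: D_def)
  interpret Z: zigzag q D using assms by unfold_locales (auto simp: D_def)
  interpret Q: polygon "map flip Z.zs" "Suc q" by unfold_locales (rule is_kgon_flip[OF Z.is_kgon_zs])
  interpret polygon_pair P.zs "Suc p" "map flip Z.zs" "Suc q" ..
  have Qreg: "Q.reg = flip ` Z.reg"
    using inside_flip[OF Z.is_kgon_zs] by (simp add: Q.reg_def Z.reg_def Q.bd_def Z.bd_def)
  let ?J = "{..<Suc p div 2} \<times> {..<Suc q div 2}"
  have "\<forall>ab\<in>?J. \<exists>y. y \<in> spine D (2 * fst ab) \<and> flip y \<in> spine D (2 * snd ab)"
  proof
    fix ab assume "ab \<in> ?J"
    then have "2 * fst ab + 1 \<le> p" "2 * snd ab + 1 \<le> q" by auto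
    then have "real (2 * fst ab) + 1 \<le> D" "real (2 * snd ab) + 1 \<le> D"
      using assms by (auto simp: D_def)
    then obtain y where "y \<in> spine D (2 * fst ab)" "flip y \<in> spine D (2 * snd ab)"
      using spines_meet[OF P.D_pos] by metis
    then show "\<exists>y. y \<in> spine D (2 * fst ab) \<and> flip y \<in> spine D (2 * snd ab)" by blast
  qed
  from bchoice[OF this] obtain c where c: "\<And>a b. (a, b) \<in> ?J \<Longrightarrow> c (a, b) \<in> spine D (2 * a)"
    "\<And>a b. (a, b) \<in> ?J \<Longrightarrow> flip (c (a, b)) \<in> spine D (2 * b)" by auto
  have mem: "c (a, b) \<in> P.reg \<inter> Q.reg" if "(a, b) \<in> ?J" for a b
  proof -
    have "2 * a < p" "2 * b < q" using that by auto
    then have "c (a, b) \<in> P.reg" "flip (c (a, b)) \<in> Z.reg"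
      using P.spine_in_reg[of "2 * a"] Z.spine_in_reg[of "2 * b"] c[OF that] by auto
    then show ?thesis using imageI[of "flip (c (a, b))" Z.reg flip] by (simp add: Qreg)
  qed
  have pos: "0 < Im y" if "y \<in> Q.reg" for y using that Z.reg_Re by (auto simp: Qreg)
  have pos': "0 < Re y" if "y \<in> P.reg" for y using that P.reg_Re by auto
  \<comment> \<open>Even the leaning spine stays left of column \<open>i + 1\<close>, so an odd
    column lies between the spines of any two teeth.\<close>
  have spineRe: "real i \<le> Re y \<and> Re y < real i + 1" if "y \<in> spine D i" for y i
    using that P.D_pos by (auto simp: spine_def slant_def field_simps)
  have sepP: "a' \<le> a" if C: "C \<in> cells" and ab: "(a, b) \<in> ?J" "(a', b') \<in> ?J" "c (a, b) \<in> C" "c (a', b') \<in> C"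
    for a b a' b' C
  proof (rule ccontr)
    assume "\<not> a' \<le> a"
    then have lt: "2 * a + 2 \<le> 2 * a'" by simp
    have "2 * a' < p" using ab by auto
    \<comment> \<open>The inner product with \<open>1\<close> is the real part: a connected cell
      containing points of two teeth must cross the odd column between them.\<close>
    have "\<exists>z\<in>C. 1 \<bullet> z = real (2 * a + 1)"
    proof (rule connected_ivt_hyperplane)
      show "connected C" using cell_props[OF C] by simp
      show "c (a, b) \<in> C" "c (a', b') \<in> C" by fact+
      show "1 \<bullet> c (a, b) \<le> real (2 * a + 1)" "real (2 * a + 1) \<le> 1 \<bullet> c (a', b')"
        using spineRe[OF c(1)[OF ab(1)]] spineRe[OF c(1)[OF ab(2)]] lt by (simp_all add: inner_complex_def)
    qed
    then obtain z where z: "z \<in> C" "Re z = real (2 * a + 1)" by (auto simp: inner_complex_def)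
    then have "Im z \<le> 0"
      using P.gap[of "2 * a + 1" z] lt \<open>2 * a' < p\<close> cell_props(3)[OF C] by auto
    then show False using pos[of z] cell_props(4)[OF C] z(1) by auto
  qed
  have sepQ: "b' \<le> b" if C: "C \<in> cells" and ab: "(a, b) \<in> ?J" "(a', b') \<in> ?J" "c (a, b) \<in> C" "c (a', b') \<in> C"
    for a b a' b' C
  proof (rule ccontr)
    assume "\<not> b' \<le> b"
    then have lt: "2 * b + 2 \<le> 2 * b'" by simp
    have "2 * b' < q" using ab by auto
    have "\<exists>z\<in>C. \<i> \<bullet> z = real (2 * b + 1)"
    proof (rule connected_ivt_hyperplane)
      show "connected C" using cell_props[OF C] by simp
      show "c (a, b) \<in> C" "c (a', b') \<in> C" by fact+
      show "\<i> \<bullet> c (a, b) \<le> real (2 * b + 1)" "real (2 * b + 1) \<le> \<i> \<bullet> c (a', b')"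
        using spineRe[OF c(2)[OF ab(1)]] spineRe[OF c(2)[OF ab(2)]] lt by (simp_all add: inner_complex_def)
    qed
    then obtain z where z: "z \<in> C" "Im z = real (2 * b + 1)" by (auto simp: inner_complex_def)
    then have "flip z \<in> Z.reg" using cell_props(4)[OF C] by (auto simp: Qreg)
    then have "Im (flip z) \<le> 0"
      using Z.gap[of "2 * b + 1" "flip z"] lt \<open>2 * b' < q\<close> z(2) by auto
    then show False using pos'[of z] cell_props(3)[OF C] z(1) by auto
  qed
  have "\<forall>ab\<in>?J. \<exists>C. C \<in> cells \<and> c ab \<in> C"
  proof
    fix ab assume "ab \<in> ?J"
    then have "c ab \<in> P.reg \<inter> Q.reg" using mem[of "fst ab" "snd ab"] by simp
    then show "\<exists>C. C \<in> cells \<and> c ab \<in> C" using ex_component by blast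
  qed
  from bchoice[OF this] obtain g where *: "\<forall>ab\<in>?J. g ab \<in> cells \<and> c ab \<in> g ab" ..
  have g: "g ab \<in> cells" "c ab \<in> g ab" if "ab \<in> ?J" for ab using bspec[OF * that] by simp_all
  have "inj_on g ?J"
  proof (rule inj_onI)
    fix u v assume uv: "u \<in> ?J" "v \<in> ?J" "g u = g v"
    obtain a b a' b' where [simp]: "u = (a, b)" "v = (a', b')" by (cases u; cases v)
    have J: "(a, b) \<in> ?J" "(a', b') \<in> ?J" using uv by simp_all
    have m: "g u \<in> cells" "c (a, b) \<in> g u" "c (a', b') \<in> g u"
      using g(1)[OF uv(1)] g(2)[OF uv(1)] g(2)[OF uv(2)] uv(3) by simp_all
    show "u = v"
      using sepP[OF m(1) J m(2,3)] sepP[OF m(1) J(2,1) m(3,2)] sepQ[OF m(1) J m(2,3)] sepQ[OF m(1) J(2,1) m(3,2)]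
      by simp
  qed
  \<comment> \<open>The injection bounds the cardinality from below because the upper bound has
    shown the family of cells to be finite.\<close>
  then have "card ?J \<le> card cells" using g(1) cells_bound(1) by (intro card_inj_on_le[of g]) auto
  then have "(Suc q div 2) * (Suc p div 2) \<le> card cells" by (simp add: card_cartesian_product mult.commute)
  moreover have "kgon_region (Suc p) P.reg" "kgon_region (Suc q) Q.reg"
    unfolding kgon_region_def P.reg_def P.bd_def Q.reg_def Q.bd_def using P.kgon Q.kgon by blast+
  ultimately show ?thesis using that cells_bound(1) by blast
qed

theorem theorem1:
  fixes n m :: nat
  assumes "3 \<le> m" and "m \<le> n"
  shows "(\<exists>P Q. kgon_region n P \<and> kgon_region m Q \<and>
            finite (components (P \<inter> Q)) \<and>
            (m div 2) * (n div 2) \<le> card (components (P \<inter> Q)))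
       \<and> (\<forall>P Q. kgon_region n P \<and> kgon_region m Q \<longrightarrow>
            finite (components (P \<inter> Q)) \<and>
            real (card (components (P \<inter> Q)))
              \<le> real (m div 2) * (real n / 2) + real m / 2)"
proof (intro conjI allI impI)
  have nm: "Suc (n - 1) = n" "Suc (m - 1) = m" "2 \<le> m - 1" "m - 1 \<le> n - 1" using assms by auto
  show "\<exists>P Q. kgon_region n P \<and> kgon_region m Q \<and> finite (components (P \<inter> Q)) \<and>
      (m div 2) * (n div 2) \<le> card (components (P \<inter> Q))"
    using many_cells[OF nm(3,4)] unfolding nm(1,2) by blast
next
  fix P Q assume "kgon_region n P \<and> kgon_region m Q"
  then obtain vs ws where vs: "is_kgon n vs" "P = inside (path_image (closed_polygon_path vs))"
    and ws: "is_kgon m ws" "Q = inside (path_image (closed_polygon_path ws))"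
    unfolding kgon_region_def by blast
  interpret P: polygon vs n by unfold_locales (rule vs)
  interpret Q: polygon ws m by unfold_locales (rule ws)
  interpret polygon_pair vs n ws m ..
  have eq: "P = P.reg" "Q = Q.reg"
    by (simp_all add: vs ws P.reg_def P.bd_def Q.reg_def Q.bd_def)
  show "finite (components (P \<inter> Q))" unfolding eq by (rule cells_bound)
  have "real (2 * card (components (P \<inter> Q))) \<le> real (n * (m div 2) + m)"
    unfolding eq using cells_bound(2) by (simp only: of_nat_le_iff)
  then show "real (card (components (P \<inter> Q))) \<le> real (m div 2) * (real n / 2) + real m / 2"
    by (simp add: field_simps del: of_nat_div)
qed

end
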